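(* Let $f\in C^1(\mathbb{R})$ and $G(x):=-|x|^2/2$ on $\mathbb{R}^n$, and consider the equation $$\mathrm{div}(a(|\nabla u|)\nabla u)-a(|\nabla u|)\langle x,\nabla u\rangle+f(u)=0. \qquad ( * )$$ Let $a(t):=t^{p-2}$ with $p>1$, and let $u\in C^1(\mathbb{R}^n)\cap W^{1,\infty}(\mathbb{R}^n)$ be a monotone weak solution to $( * )$, i.e. a weak solution such that, for some $i\in\{1,\dots,n\}$, $\partial_iu(x)>0$ for all $x\in\mathbb{R}^n$. Suppose that $u$ satisfies at least one of the following: (a) there exists $C_0\geq 1$ such that $\int_{B_R}a(|\nabla u|)|\nabla u|^2\,d\mu\leq C_0R^2$ for any $R\geq C_0$; (b) $n=2$ and $a(|\nabla u|)|\nabla u|^2e^{G}\in L^\infty(\mathbb{R}^2)$. Then $u$ is one-dimensional, i.e. there exist $\omega\in\mathbb{S}^{n-1}$ and $u_0:\mathbb{R}\to\mathbb{R}$ such that $u(x)=u_0(\langle\omega,x\rangle)$ for all $x\in\mathbb{R}^n$. Moreover, if either $a(t)=t^{p-2}$ with $p=2$ (i.e. $a\equiv1$), or $a(t):=(1+t^q)^{-1/q}$ with $q>1$, then the same conclusion (that $u$ is one-dimensional) holds for every monotone weak solution $u\in C^1(\mathbb{R}^n)\cap L^\infty(\mathbb{R}^n)$ of $( * )$.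
   Context: Notation: $d\mu=e^{G(x)}dx=e^{-|x|^2/2}dx$; $B_R=\{y\in\mathbb{R}^n:|y|<R\}$. Weak solution: $u$ is a weak solution of $( * )$ if $u\in C^1(\mathbb{R}^n)$, $\int_{\mathbb{R}^n}\langle a(|\nabla u|)\nabla u,\nabla\varphi\rangle-f(u)\varphi\,d\mu=0$ for all $\varphi\in C^1_c(\mathbb{R}^n)$, and at least one of the following holds: (A1) $\{\nabla u=0\}=\emptyset$; (A2) $a$ extends to $a\in C^0([0,+\infty))$ and $t\mapsto ta(t)$ belongs to $C^1([0,+\infty))$. *)

theory Defs
  imports "HOL-Analysis.Analysis"
begin

definition gradient :: "(real ^ 'n \<Rightarrow> real) \<Rightarrow> real ^ 'n \<Rightarrow> real ^ 'n" where
  "gradient u x = (\<chi> i. frechet_derivative u (at x) (axis i 1))"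

definition C1 :: "(real ^ 'n \<Rightarrow> real) \<Rightarrow> bool" where
  "C1 u \<longleftrightarrow> (\<forall>x. u differentiable (at x)) \<and> continuous_on UNIV (gradient u)"

definition C1_compact_support :: "(real ^ 'n \<Rightarrow> real) \<Rightarrow> bool" where
  "C1_compact_support \<phi> \<longleftrightarrow> C1 \<phi> \<and> compact (closure {x. \<phi> x \<noteq> 0})"

(* One-sided derivative at 0: the library's C1_differentiable_on takes two-sided
   derivatives at every point of the set, which is too strong at the endpoint. *)
definition C1_halfline :: "(real \<Rightarrow> real) \<Rightarrow> bool" where
  "C1_halfline g \<longleftrightarrow> (\<exists>D. (\<forall>t\<in>{0..}. (g has_real_derivative D t) (at t within {0..}))
                        \<and> continuous_on {0..} D)"

definition L_infinity :: "(real ^ 'n \<Rightarrow> real) \<Rightarrow> bool" where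
  "L_infinity g \<longleftrightarrow> g \<in> borel_measurable lebesgue \<and> (\<exists>C. AE x in lebesgue. \<bar>g x\<bar> \<le> C)"

(* Weak derivatives are tested against C1 functions with compact support; by mollification
   this is equivalent to testing against smooth functions with compact support. *)
definition weak_gradient :: "(real ^ 'n \<Rightarrow> real) \<Rightarrow> (real ^ 'n \<Rightarrow> real ^ 'n) \<Rightarrow> bool" where
  "weak_gradient u v \<longleftrightarrow>
     (\<forall>\<phi> i. C1_compact_support \<phi> \<longrightarrow>
        (\<integral>x. u x * gradient \<phi> x $ i \<partial>lebesgue) = - (\<integral>x. v x $ i * \<phi> x \<partial>lebesgue))"

definition W_1_infinity :: "(real ^ 'n \<Rightarrow> real) \<Rightarrow> bool" where
  "W_1_infinity u \<longleftrightarrow>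
     L_infinity u \<and> (\<exists>v. (\<forall>i. L_infinity (\<lambda>x. v x $ i)) \<and> weak_gradient u v)"

definition G :: "real ^ 'n \<Rightarrow> real" where
  "G x = - (norm x)\<^sup>2 / 2"

definition \<mu> :: "(real ^ 'n) measure" where
  "\<mu> = density lborel (\<lambda>x. ennreal (exp (G x)))"

(* The coefficient a is a function on the open half-line (0,\<infinity>); its value at 0 is immaterial,
   since in every use below a(|\<nabla>u|) is multiplied by \<nabla>u or by |\<nabla>u|^2. *)
definition weak_solution ::
    "(real \<Rightarrow> real) \<Rightarrow> (real \<Rightarrow> real) \<Rightarrow> (real ^ 'n \<Rightarrow> real) \<Rightarrow> bool" where
  "weak_solution a f u \<longleftrightarrow>
     C1 u \<and>
     (\<forall>\<phi>. C1_compact_support \<phi> \<longrightarrow>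
        (\<integral>x. (a (norm (gradient u x)) *\<^sub>R gradient u x) \<bullet> gradient \<phi> x - f (u x) * \<phi> x \<partial>\<mu>) = 0) \<and>
     ({x. gradient u x = 0} = {} \<or>
      (\<exists>b. (\<forall>t>0. b t = a t) \<and> continuous_on {0..} b \<and> C1_halfline (\<lambda>t. t * b t)))"

definition monotone_weak_solution ::
    "(real \<Rightarrow> real) \<Rightarrow> (real \<Rightarrow> real) \<Rightarrow> (real ^ 'n \<Rightarrow> real) \<Rightarrow> bool" where
  "monotone_weak_solution a f u \<longleftrightarrow> weak_solution a f u \<and> (\<exists>i. \<forall>x. gradient u x $ i > 0)"

definition energy_density ::
    "(real \<Rightarrow> real) \<Rightarrow> (real ^ 'n \<Rightarrow> real) \<Rightarrow> real ^ 'n \<Rightarrow> real" where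
  "energy_density a u x = a (norm (gradient u x)) * (norm (gradient u x))\<^sup>2"

definition one_dimensional :: "(real ^ 'n \<Rightarrow> real) \<Rightarrow> bool" where
  "one_dimensional u \<longleftrightarrow> (\<exists>\<omega>\<in>sphere 0 1. \<exists>u\<^sub>0 :: real \<Rightarrow> real. \<forall>x. u x = u\<^sub>0 (\<omega> \<bullet> x))"

end

theory Submission
  imports Defs
begin

text \<open>
  Since \<open>\<partial>\<^sub>i u > 0\<close>, the gradient never vanishes and the coefficient is smooth along it. The equation is
  differentiated with difference quotients instead of second derivatives: for a direction \<open>v\<close>, the quotient
  \<open>D\<^sub>v u\<close> solves an approximate linearised equation whose zero-order coefficient does not depend on \<open>v\<close>.
  Testing the equation of \<open>W = D\<^sub>v u\<close> with \<open>\<eta>\<^sup>2 W\<close>, that of \<open>H = D\<^sub>i u > 0\<close> with \<open>\<eta>\<^sup>2 W\<^sup>2 / H\<close>, and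
  subtracting (Picone's identity), one obtains
  \<open>\<integral> \<eta>\<^sup>2 H\<^sup>2 \<langle>A \<nabla>(W/H), \<nabla>(W/H)\<rangle> d\<mu> \<le> C \<integral> a(|\<nabla>u|) |\<nabla>u|\<^sup>2 |\<nabla>\<eta>|\<^sup>2 d\<mu> + o(1)\<close>, where \<open>A\<close> is the
  derivative of \<open>z \<mapsto> a(|z|) z\<close> at \<open>\<nabla>u\<close>. Under quadratic energy growth, logarithmic cut-offs make the right-hand
  side arbitrarily small, so all ratios \<open>\<partial>\<^sub>v u / \<partial>\<^sub>i u\<close> are constant and \<open>\<nabla>u\<close> has a fixed direction.
  For bounded \<open>u\<close> and \<open>a \<le> 1\<close>, testing the equation itself with \<open>u \<eta>\<^sup>2\<close> bounds the energy, because \<open>\<mu>\<close> is finite.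
\<close>

section \<open>Gradients, test functions and the Gaussian weight\<close>

text \<open>Since \<open>u\<close> is only C1, the difference quotient of the flux cannot be
  compared with a linearised flux exactly: \<open>P\<close> agrees with
  \<open>DF (gu x) (gD t v x)\<close> up to an error that is small relative to \<open>gD\<close>.
  Such errors enter the Picone estimate as a small factor times the squared norm of
  \<open>gD\<close>, and the Caccioppoli bound, uniform in small \<open>t\<close> for a fixed
  cut-off, is what makes them vanish. This forces the order of limits: fix a ball, choose the
  cut-off, and only then let \<open>t\<close> tend to 0. That \<kappa> is the same for every
  direction is decisive. With s = W/H the two zero-order contributions are \<kappa> W * \<eta>^2 W
  and \<kappa> H * \<eta>^2 s W; they cancel on subtraction whatever the sign of \<kappa>, so no
  sign of f' enters. The energy appears on the right because the cut-off term carries the square of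
  \<partial>_v u, which is at most |\<nabla>u|^2 for |v| <= 1, while the eigenvalues of A are at
  most M a(|\<nabla>u|).\<close>

lemma C1_has_derivative:
  assumes "C1 u"
  shows "(u has_derivative (\<lambda>h. gradient u x \<bullet> h)) (at x)"
proof -
  have d: "(u has_derivative frechet_derivative u (at x)) (at x)"
    using assms by (simp add: C1_def frechet_derivative_works[symmetric])
  then have lin: "linear (frechet_derivative u (at x))"
    by (rule has_derivative_linear)
  have "frechet_derivative u (at x) h = gradient u x \<bullet> h" for h
  proof -
    have "frechet_derivative u (at x) h = frechet_derivative u (at x) (\<Sum>i\<in>UNIV. h $ i *\<^sub>R axis i 1)"
      using basis_expansion[of h] by (simp add: scalar_mult_eq_scaleR)
    also have "\<dots> = gradient u x \<bullet> h"
      unfolding linear_sum[OF lin] linear_scale[OF lin]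
      by (simp add: gradient_def inner_vec_def mult.commute)
    finally show ?thesis .
  qed
  then have "frechet_derivative u (at x) = (\<lambda>h. gradient u x \<bullet> h)" ..
  with d show ?thesis by simp
qed

lemma gradient_unique:
  assumes "(u has_derivative (\<lambda>h. g \<bullet> h)) (at x)"
  shows "gradient u x = g"
proof -
  have "frechet_derivative u (at x) = (\<lambda>h. g \<bullet> h)"
    using frechet_derivative_at[OF assms] by simp
  then show ?thesis
    by (simp add: gradient_def vec_eq_iff inner_axis)
qed

lemma C1_compact_supportI:
  assumes "\<And>x. (\<phi> has_derivative (\<lambda>h. g x \<bullet> h)) (at x)" "continuous_on UNIV g"
    and "\<And>x. norm x > R \<Longrightarrow> \<phi> x = 0"
  shows "C1_compact_support \<phi>" "gradient \<phi> = g"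
proof -
  show g: "gradient \<phi> = g" using gradient_unique[OF assms(1)] by auto
  have "{x. \<phi> x \<noteq> 0} \<subseteq> cball 0 R" using assms(3) by force
  then have "bounded {x. \<phi> x \<noteq> 0}" using bounded_cball bounded_subset by blast
  then have "compact (closure {x. \<phi> x \<noteq> 0})" by (simp add: compact_closure)
  then show "C1_compact_support \<phi>"
    using assms(1,2) g unfolding C1_compact_support_def C1_def differentiable_def by metis
qed

lemma integrable_indicator_compact:
  fixes g :: "'a::euclidean_space \<Rightarrow> real"
  assumes "compact K" "continuous_on UNIV g"
  shows "integrable lborel (\<lambda>x. indicator K x * g x)"
  using borel_integrable_compact[OF assms(1) continuous_on_subset[OF assms(2) subset_UNIV]] by simp

lemma integrable_continuous_compact_support:
  fixes g :: "'a::euclidean_space \<Rightarrow> real"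
  assumes "continuous_on UNIV g" "\<And>x. norm x > R \<Longrightarrow> g x = 0"
  shows "integrable lborel g"
proof -
  have "integrable lborel (\<lambda>x. indicator (cball 0 R) x * g x)"
    by (intro integrable_indicator_compact assms(1)) auto
  moreover have "(\<lambda>x. indicator (cball 0 R) x * g x) = g"
    using assms(2) by (auto simp: indicator_def fun_eq_iff not_le)
  ultimately show ?thesis by simp
qed

lemma integral_lborel_shift:
  fixes g :: "'a::euclidean_space \<Rightarrow> real"
  assumes "g \<in> borel_measurable borel"
  shows "(\<integral>x. g (x + y) \<partial>lborel) = (\<integral>x. g x \<partial>lborel)"
proof -
  have "(\<integral>x. g x \<partial>lborel) = (\<integral>x. g x \<partial>(distr lborel borel ((+) y)))"
    by (simp add: lborel_distr_plus)
  also have "\<dots> = (\<integral>x. g (y + x) \<partial>lborel)"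
    using assms by (subst integral_distr) auto
  finally show ?thesis by (simp add: add.commute)
qed

section \<open>The Gaussian density: translation and total mass\<close>

definition rho :: "real ^ 'n \<Rightarrow> real" where
  "rho x = exp (G x)"

lemma rho_pos [simp]: "rho x > 0" and rho_nonneg [simp]: "rho x \<ge> 0"
  by (simp_all add: rho_def)

lemma continuous_on_rho [continuous_intros]:
  "continuous_on S g \<Longrightarrow> continuous_on S (\<lambda>x. rho (g x))"
  unfolding rho_def G_def by (intro continuous_intros) auto

text \<open>Expand the squared norm around \<open>x - y\<close>. The exponential is the price of
  translating the Gaussian weight; a translated test function must carry its inverse.\<close>

lemma rho_shift: "rho x = rho (x - y) * exp (- (y \<bullet> (x - y)) - (norm y)\<^sup>2 / 2)"
proof -
  have "(norm x)\<^sup>2 = (norm (x - y))\<^sup>2 + 2 * (y \<bullet> (x - y)) + (norm y)\<^sup>2"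
    by (simp add: power2_norm_eq_inner algebra_simps inner_commute)
  then show ?thesis
    unfolding rho_def G_def by (simp add: exp_add[symmetric] field_simps)
qed

lemma integral_mu:
  assumes "g \<in> borel_measurable borel"
  shows "(\<integral>x. g x \<partial>\<mu>) = (\<integral>x. rho x * g x \<partial>lborel)"
proof -
  have m: "(\<lambda>x::real^'n. exp (G x)) \<in> borel_measurable borel"
    using continuous_on_rho[OF continuous_on_id, of UNIV]
    unfolding rho_def by (intro borel_measurable_continuous_onI) auto
  show ?thesis
    unfolding \<mu>_def rho_def using m assms by (subst integral_density) auto
qed

text \<open>Compare with shells: for k <= |x| < k + 1 the density is at most exp(-k^2/2), and the
  enclosing ball has volume of order (k+1)^n. Finiteness of this mass lets constant error terms be
  integrated over the whole space.\<close>

lemma gaussian_finite: "integrable lborel (rho :: real ^ 'n \<Rightarrow> real)"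
proof -
  have m: "(rho :: real ^ 'n \<Rightarrow> real) \<in> borel_measurable borel"
    by (intro borel_measurable_continuous_onI continuous_on_rho continuous_on_id)
  let ?n = "CARD('n)"
  let ?V = "unit_ball_vol ?n"
  define c where "c k = exp (- (real k)\<^sup>2 / 2) * (real (Suc k))^?n" for k :: nat
  have "ennreal (rho x) \<le> (\<Sum>k. ennreal (exp (- (real k)\<^sup>2 / 2)) * indicator (ball 0 (Suc k)) x)" for x :: "real^'n"
  proof -
    define k where "k = nat \<lfloor>norm x\<rfloor>"
    have k: "real k \<le> norm x" "norm x < Suc k"
      unfolding k_def by (auto simp: of_nat_nat) linarith
    have "ennreal (rho x) \<le> ennreal (exp (- (real k)\<^sup>2 / 2)) * indicator (ball 0 (Suc k)) x"
      using k by (auto simp: rho_def G_def indicator_def intro!: ennreal_leI power_mono)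
    also have "\<dots> \<le> (\<Sum>k. ennreal (exp (- (real k)\<^sup>2 / 2)) * indicator (ball 0 (Suc k)) x)"
      using sum_le_suminf[of "\<lambda>k. ennreal (exp (- (real k)\<^sup>2 / 2)) * indicator (ball 0 (Suc k)) x" "{k}"]
      by (simp del: sum_mult_indicator)
    finally show ?thesis .
  qed
  then have "(\<integral>\<^sup>+x. ennreal (rho (x::real^'n)) \<partial>lborel)
     \<le> (\<integral>\<^sup>+x. (\<Sum>k. ennreal (exp (- (real k)\<^sup>2 / 2)) * indicator (ball 0 (Suc k)) x) \<partial>(lborel::(real^'n) measure))"
    by (intro nn_integral_mono) auto
  also have "\<dots> = (\<Sum>k. ennreal (exp (- (real k)\<^sup>2 / 2)) * emeasure lborel (ball (0::real^'n) (Suc k)))"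
    by (subst nn_integral_suminf)
       (auto simp: nn_integral_cmult_indicator intro!: borel_measurable_times_ennreal borel_measurable_indicator)
  also have "\<dots> = (\<Sum>k. ennreal (?V * c k))"
    by (intro suminf_cong)
       (auto simp: c_def emeasure_ball ennreal_mult[symmetric] unit_ball_vol_nonneg mult_ac)
  also have "\<dots> < \<infinity>"
  proof -
    have "summable c"
    proof (rule summable_comparison_test')
      show "summable (\<lambda>k. (fact ?n * exp 3) * exp (-1::real) ^ k)"
        by (intro summable_mult summable_geometric) auto
      fix k :: nat
      \<comment> \<open>A single term of the exponential series dominates the power, so the tail
        becomes geometric.\<close>
      have "(real (Suc k))^?n / fact ?n \<le> exp (real (Suc k))"
        using sum_le_suminf[OF summable_exp, of "{?n}" "real (Suc k)"]
        by (simp add: exp_def field_simps)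
      then have "c k \<le> exp (- (real k)\<^sup>2 / 2) * (fact ?n * exp (real (Suc k)))"
        unfolding c_def by (intro mult_left_mono) (auto simp: field_simps)
      also have "\<dots> = fact ?n * exp (- (real k)\<^sup>2 / 2 + real (Suc k))"
        by (simp only: exp_add mult_ac)
      also have "\<dots> \<le> fact ?n * exp (3 - real k)"
      proof -
        \<comment> \<open>Half of this square is the gap between -k^2/2 + k + 1 and 3 - k, which is
          where the 3 comes from.\<close>
        have "0 \<le> (real k - 2)\<^sup>2" by simp
        then show ?thesis by (simp add: power2_eq_square field_simps)
      qed
      also have "\<dots> = (fact ?n * exp 3) * exp (-1) ^ k"
        by (simp add: exp_diff exp_of_nat_mult[symmetric] exp_minus field_simps)
      finally show "norm (c k) \<le> (fact ?n * exp 3) * exp (-1) ^ k"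
        by (simp add: c_def)
    qed
    then have "summable (\<lambda>k. ?V * c k)" by (rule summable_mult)
    moreover have "0 \<le> ?V * c k" for k
      by (auto simp: c_def unit_ball_vol_nonneg)
    ultimately show ?thesis
      by (subst suminf_ennreal2) auto
  qed
  finally show ?thesis
    using m by (intro integrableI_nonneg) auto
qed

section \<open>Structure of the elliptic coefficient\<close>

text \<open>With t = |z|, the derivative of the map sending z to a(|z|) z has eigenvalue a(t)
  orthogonally to z and a(t) + t a'(t) along z. Both are to be positive away from the origin, and
  the radial one at most \<open>M\<close> times the tangential one; the behaviour as t tends to 0 is
  left free so that singular and degenerate powers fit.\<close>

locale elliptic =
  fixes a a' :: "real \<Rightarrow> real" and M :: real
  assumes a_deriv: "\<And>t. t > 0 \<Longrightarrow> (a has_real_derivative a' t) (at t)"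
    and a'_cont: "continuous_on {0<..} a'"
    and a_pos: "\<And>t. t > 0 \<Longrightarrow> 0 < a t"
    and radial_pos: "\<And>t. t > 0 \<Longrightarrow> 0 < a t + t * a' t"
    and radial_le: "\<And>t. t > 0 \<Longrightarrow> a t + t * a' t \<le> M * a t"
    and M_ge1: "1 \<le> M"
begin

definition F :: "'v::euclidean_space \<Rightarrow> 'v" where
  "F z = a (norm z) *\<^sub>R z"

definition DF :: "'v::euclidean_space \<Rightarrow> 'v \<Rightarrow> 'v" where
  "DF z \<zeta> = a (norm z) *\<^sub>R \<zeta> + (a' (norm z) / norm z * (z \<bullet> \<zeta>)) *\<^sub>R z"

text \<open>Lower ellipticity constant of \<open>DF z\<close>: the smaller of its tangential and
  radial eigenvalues.\<close>

definition ell :: "'v::euclidean_space \<Rightarrow> real" where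
  "ell z = min (a (norm z)) (a (norm z) + norm z * a' (norm z))"

lemma a_cont: "continuous_on {0<..} a"
  using a_deriv DERIV_isCont by (intro continuous_at_imp_continuous_on) auto

lemma F_has_derivative:
  assumes "z \<noteq> 0"
  shows "(F has_derivative DF z) (at z)"
proof -
  have *: "((\<lambda>x. a (norm x)) has_derivative (\<lambda>h. (h \<bullet> sgn z) * a' (norm z))) (at z)"
    by (rule has_derivative_compose[OF has_derivative_norm[OF assms]
         a_deriv[of "norm z", THEN has_field_derivative_imp_has_derivative, unfolded mult.commute[of "a' _"]]])
       (use assms in auto)
  have "(F has_derivative (\<lambda>h. a (norm z) *\<^sub>R h + ((h \<bullet> sgn z) * a' (norm z)) *\<^sub>R z)) (at z)"
    unfolding F_def by (rule has_derivative_scaleR[OF * has_derivative_ident])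
  moreover have "(\<lambda>h. a (norm z) *\<^sub>R h + ((h \<bullet> sgn z) * a' (norm z)) *\<^sub>R z) = DF z"
    by (auto simp: DF_def sgn_div_norm inner_commute divide_inverse mult_ac)
  ultimately show ?thesis by simp
qed

section \<open>Ellipticity bounds for the linearised flux\<close>

lemma DF_add: "DF z (x + y) = DF z x + DF z y"
  and DF_diff: "DF z (x - y) = DF z x - DF z y"
  and DF_scale: "DF z (c *\<^sub>R x) = c *\<^sub>R DF z x"
  by (auto simp: DF_def algebra_simps inner_add_right inner_diff_right)

lemma DF_sym: "DF z x \<bullet> y = DF z y \<bullet> x"
  by (simp add: DF_def inner_add_left inner_add_right inner_commute)

lemma DF_form: "DF z x \<bullet> y = a (norm z) * (x \<bullet> y) + a' (norm z) / norm z * (z \<bullet> x) * (z \<bullet> y)"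
  by (simp add: DF_def inner_add_left)

text \<open>The form is a|x|^2 plus a rank-one term with coefficient \<open>b\<close>. A nonnegative
  \<open>b\<close> lets that term be dropped; for negative \<open>b\<close>, Cauchy-Schwarz gives
  the worst case, which is the radial eigenvalue.\<close>

lemma DF_lower:
  assumes "z \<noteq> 0" shows "ell z * (norm x)\<^sup>2 \<le> DF z x \<bullet> x"
proof -
  define b where "b = a' (norm z) / norm z"
  have n: "norm z > 0" using assms by simp
  have form: "DF z x \<bullet> x = a (norm z) * (norm x)\<^sup>2 + b * (z \<bullet> x)\<^sup>2"
    unfolding DF_form b_def power2_norm_eq_inner by (simp add: power2_eq_square mult.assoc)
  have cs: "(z \<bullet> x)\<^sup>2 \<le> (norm z)\<^sup>2 * (norm x)\<^sup>2"
    using Cauchy_Schwarz_ineq[of z x] by (simp add: power2_norm_eq_inner)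
  have e: "ell z = min (a (norm z)) (a (norm z) + b * (norm z)\<^sup>2)"
    using n by (simp add: ell_def b_def power2_eq_square mult.commute)
  show ?thesis
  proof (cases "b \<ge> 0")
    case True
    have "ell z * (norm x)\<^sup>2 \<le> a (norm z) * (norm x)\<^sup>2" unfolding e by (intro mult_right_mono) auto
    moreover have "0 \<le> b * (z \<bullet> x)\<^sup>2" using True by simp
    ultimately show ?thesis unfolding form by linarith
  next
    case False
    have "ell z * (norm x)\<^sup>2 \<le> (a (norm z) + b * (norm z)\<^sup>2) * (norm x)\<^sup>2"
      unfolding e by (intro mult_right_mono) auto
    moreover have "b * ((norm z)\<^sup>2 * (norm x)\<^sup>2) \<le> b * (z \<bullet> x)\<^sup>2"
      using False cs by (intro mult_left_mono_neg) auto
    ultimately show ?thesis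
      unfolding form by (simp add: algebra_simps)
  qed
qed

lemma ell_pos: "z \<noteq> 0 \<Longrightarrow> 0 < ell z"
  using a_pos[of "norm z"] radial_pos[of "norm z"] by (auto simp: ell_def)

lemma DF_nonneg: "z \<noteq> 0 \<Longrightarrow> 0 \<le> DF z x \<bullet> x"
  using DF_lower[of z x] ell_pos[of z] by (smt (verit) mult_nonneg_nonneg zero_le_power2)

text \<open>The splitting of \<open>DF_lower\<close> with the signs exchanged:
  \<open>radial_le\<close> handles b >= 0 and \<open>M_ge1\<close> handles b < 0.\<close>

lemma DF_upper:
  assumes "z \<noteq> 0" shows "DF z x \<bullet> x \<le> M * a (norm z) * (norm x)\<^sup>2"
proof -
  define b where "b = a' (norm z) / norm z"
  have n: "norm z > 0" using assms by simp
  have form: "DF z x \<bullet> x = a (norm z) * (norm x)\<^sup>2 + b * (z \<bullet> x)\<^sup>2"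
    unfolding DF_form b_def power2_norm_eq_inner by (simp add: power2_eq_square mult.assoc)
  have cs: "(z \<bullet> x)\<^sup>2 \<le> (norm z)\<^sup>2 * (norm x)\<^sup>2"
    using Cauchy_Schwarz_ineq[of z x] by (simp add: power2_norm_eq_inner)
  have u: "a (norm z) + b * (norm z)\<^sup>2 \<le> M * a (norm z)"
    using radial_le[OF n] n by (simp add: b_def power2_eq_square mult.commute)
  have u1: "a (norm z) \<le> M * a (norm z)" using M_ge1 a_pos[OF n] by simp
  show ?thesis
  proof (cases "b \<ge> 0")
    case True
    have "(a (norm z) + b * (norm z)\<^sup>2) * (norm x)\<^sup>2 \<le> M * a (norm z) * (norm x)\<^sup>2"
      using u by (intro mult_right_mono) auto
    moreover have "b * (z \<bullet> x)\<^sup>2 \<le> b * ((norm z)\<^sup>2 * (norm x)\<^sup>2)"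
      using True cs by (intro mult_left_mono) auto
    ultimately show ?thesis
      unfolding form by (simp add: algebra_simps)
  next
    case False
    have "a (norm z) * (norm x)\<^sup>2 \<le> M * a (norm z) * (norm x)\<^sup>2" using u1 by (intro mult_right_mono) auto
    moreover have "b * (z \<bullet> x)\<^sup>2 \<le> 0" using False by (intro mult_nonpos_nonneg) auto
    ultimately show ?thesis unfolding form by linarith
  qed
qed

lemma DF_norm:
  assumes "z \<noteq> 0"
  shows "norm (DF z x) \<le> (a (norm z) + \<bar>a' (norm z)\<bar> * norm z) * norm x"
proof -
  have n: "norm z > 0" using assms by simp
  have "norm (DF z x) \<le> norm (a (norm z) *\<^sub>R x) + norm ((a' (norm z) / norm z * (z \<bullet> x)) *\<^sub>R z)"
    unfolding DF_def by (rule norm_triangle_ineq)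
  also have "\<dots> = a (norm z) * norm x + \<bar>a' (norm z)\<bar> * \<bar>z \<bullet> x\<bar>"
    using n a_pos[OF n] by (simp add: abs_mult)
  also have "\<dots> \<le> a (norm z) * norm x + \<bar>a' (norm z)\<bar> * (norm z * norm x)"
    by (intro add_left_mono mult_left_mono Cauchy_Schwarz_ineq2) auto
  finally show ?thesis by (simp add: algebra_simps)
qed

section \<open>Continuity and uniform linearisation of the flux\<close>

lemma continuous_on_a_norm [continuous_intros]:
  assumes "continuous_on S g" "\<And>x. x \<in> S \<Longrightarrow> g x \<noteq> 0"
  shows "continuous_on S (\<lambda>x. a (norm (g x)))" "continuous_on S (\<lambda>x. a' (norm (g x)))"
  by (rule continuous_on_compose2[OF a_cont] continuous_on_compose2[OF a'_cont];
      use assms in \<open>auto intro!: continuous_intros\<close>)+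

lemma continuous_on_F [continuous_intros]:
  assumes "continuous_on S g" "\<And>x. x \<in> S \<Longrightarrow> g x \<noteq> 0"
  shows "continuous_on S (\<lambda>x. F (g x))"
  unfolding F_def using assms by (intro continuous_intros) auto

lemma continuous_on_DF [continuous_intros]:
  assumes "continuous_on S g" "\<And>x. x \<in> S \<Longrightarrow> g x \<noteq> 0" "continuous_on S k"
  shows "continuous_on S (\<lambda>x. DF (g x) (k x))"
  unfolding DF_def using assms by (intro continuous_intros) auto

text \<open>\<open>DF z\<close> is a multiple of the identity plus a rank-one map. Telescoping the
  rank-one part isolates the increment of (a'(|z|)/|z|) z, so mere continuity of \<open>a'\<close>
  controls the variation of \<open>DF\<close>.\<close>

lemma DF_diff_onorm:
  "onorm (DF z - DF z0) \<le> \<bar>a (norm z) - a (norm z0)\<bar>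
     + norm ((a' (norm z) / norm z) *\<^sub>R z - (a' (norm z0) / norm z0) *\<^sub>R z0) * norm z
     + norm ((a' (norm z0) / norm z0) *\<^sub>R z0) * norm (z - z0)" (is "_ \<le> ?B")
proof (rule onorm_le)
  fix x
  let ?b = "\<lambda>z. (a' (norm z) / norm z) *\<^sub>R z"
  have e: "(DF z - DF z0) x = (a (norm z) - a (norm z0)) *\<^sub>R x + ((?b z - ?b z0) \<bullet> x) *\<^sub>R z
      + (?b z0 \<bullet> x) *\<^sub>R (z - z0)"
    by (simp add: DF_def algebra_simps inner_diff_left)
  have "norm ((DF z - DF z0) x) \<le> norm ((a (norm z) - a (norm z0)) *\<^sub>R x) + norm (((?b z - ?b z0) \<bullet> x) *\<^sub>R z)
      + norm ((?b z0 \<bullet> x) *\<^sub>R (z - z0))"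
    unfolding e by (intro order_trans[OF norm_triangle_ineq] add_mono order_refl norm_triangle_ineq)
  also have "\<dots> = \<bar>a (norm z) - a (norm z0)\<bar> * norm x + \<bar>(?b z - ?b z0) \<bullet> x\<bar> * norm z
      + \<bar>?b z0 \<bullet> x\<bar> * norm (z - z0)"
    by (simp only: norm_scaleR real_norm_def)
  also have "\<dots> \<le> \<bar>a (norm z) - a (norm z0)\<bar> * norm x + (norm (?b z - ?b z0) * norm x) * norm z
      + (norm (?b z0) * norm x) * norm (z - z0)"
    by (intro add_mono mult_right_mono Cauchy_Schwarz_ineq2) auto
  also have "\<dots> = ?B * norm x" by (simp add: algebra_simps)
  finally show "norm ((DF z - DF z0) x) \<le> ?B * norm x" .
qed

text \<open>Convexity of \<open>Z\<close> keeps the segments away from the singularity of \<open>F\<close> at the origin.\<close>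

lemma F_uniform_linearization:
  fixes Z :: "'v::euclidean_space set"
  assumes "compact Z" "convex Z" "0 \<notin> Z" "\<epsilon> > 0"
  shows "\<exists>\<delta>>0. \<forall>z\<in>Z. \<forall>z'\<in>Z. norm (z' - z) < \<delta> \<longrightarrow>
           norm (F z' - F z - DF z (z' - z)) \<le> \<epsilon> * norm (z' - z)"
proof (cases "Z = {}")
  case True then show ?thesis using assms(4) by (intro exI[of _ 1]) auto
next
  case False
  have nz: "\<And>z. z \<in> Z \<Longrightarrow> z \<noteq> 0" using assms(3) by auto
  let ?b = "\<lambda>z::'v. (a' (norm z) / norm z) *\<^sub>R z"
  have cb: "continuous_on Z ?b" using nz by (intro continuous_intros) auto
  have ca: "continuous_on Z (\<lambda>z. a (norm z))" using nz by (intro continuous_intros) auto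
  obtain B0 where B0: "\<And>z. z \<in> Z \<Longrightarrow> norm z \<le> B0" 
    using compact_imp_bounded[OF assms(1)] by (auto simp: bounded_iff)
  obtain B1 where B1: "\<And>z. z \<in> Z \<Longrightarrow> norm (?b z) \<le> B1" 
    using compact_imp_bounded[OF compact_continuous_image[OF cb assms(1)]] by (auto simp: bounded_iff)
  define B where "B = max 1 (max B0 B1)"
  have B: "B \<ge> 1" "\<And>z. z \<in> Z \<Longrightarrow> norm z \<le> B" "\<And>z. z \<in> Z \<Longrightarrow> norm (?b z) \<le> B"
    using B0 B1 unfolding B_def by (auto simp: le_max_iff_disj)
  \<comment> \<open>Each of the three terms in \<open>DF_diff_onorm\<close> will be at most e B,
    hence the 3.\<close>
  define e where "e = \<epsilon> / (3 * B)"
  have e: "e > 0" using assms(4) B(1) by (simp add: e_def)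
  obtain d1 where d1: "d1 > 0" "\<And>z z'. z \<in> Z \<Longrightarrow> z' \<in> Z \<Longrightarrow> dist z' z < d1 \<Longrightarrow> dist (?b z') (?b z) < e"
    using compact_uniformly_continuous[OF cb assms(1)] e unfolding uniformly_continuous_on_def by metis
  obtain d2 where d2: "d2 > 0" "\<And>z z'. z \<in> Z \<Longrightarrow> z' \<in> Z \<Longrightarrow> dist z' z < d2 \<Longrightarrow> dist (a (norm z')) (a (norm z)) < e"
    using compact_uniformly_continuous[OF ca assms(1)] e unfolding uniformly_continuous_on_def by metis
  define d where "d = min (min d1 d2) e"
  have d: "d > 0" using d1 d2 e by (simp add: d_def)
  have on: "onorm (DF z' - DF z) \<le> \<epsilon>" if "z \<in> Z" "z' \<in> Z" "dist z' z < d" for z z'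
  proof -
    have "onorm (DF z' - DF z) \<le> \<bar>a (norm z') - a (norm z)\<bar> + norm (?b z' - ?b z) * norm z' + norm (?b z) * norm (z' - z)"
      by (rule DF_diff_onorm)
    also have "\<dots> \<le> e * B + e * B + B * e"
    proof (intro add_mono mult_mono)
      show "\<bar>a (norm z') - a (norm z)\<bar> \<le> e * B"
      proof -
        have "\<bar>a (norm z') - a (norm z)\<bar> < e" using d2(2)[OF that(1,2)] that(3) by (simp add: d_def dist_real_def)
        also have "e \<le> e * B" using e B(1) by simp
        finally show ?thesis by simp
      qed
      show "norm (?b z' - ?b z) \<le> e" using d1(2)[OF that(1,2)] that(3) by (simp add: d_def dist_norm)
      show "norm (z' - z) \<le> e" using that(3) by (simp add: d_def dist_norm)
    qed (use B e that in auto)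
    also have "\<dots> = \<epsilon>" using B(1) by (simp add: e_def)
    finally show ?thesis .
  qed
  show ?thesis
  proof (intro exI[of _ d] conjI d ballI impI)
    fix z z' assume z: "z \<in> Z" "z' \<in> Z" "norm (z' - z) < d"
    have seg: "z + t *\<^sub>R (z' - z) \<in> Z \<inter> ball z d" if "t \<in> {0..1}" for t
    proof -
      have "z + t *\<^sub>R (z' - z) = (1 - t) *\<^sub>R z + t *\<^sub>R z'" by (simp add: algebra_simps)
      then have "z + t *\<^sub>R (z' - z) \<in> Z" using that z assms(2) by (simp add: convexD_alt)
      moreover have "norm (t *\<^sub>R (z' - z)) \<le> 1 * norm (z' - z)"
        using that by (simp only: norm_scaleR) (intro mult_right_mono, auto)
      ultimately show ?thesis using z by (simp add: dist_norm)
    qed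
    \<comment> \<open>Mean value inequality for \<open>F\<close> minus its linearisation at
      \<open>z\<close>, on the part of \<open>Z\<close> where \<open>DF\<close> differs from
      \<open>DF z\<close> by at most \<epsilon> in operator norm.\<close>
    have "norm (F z' - F z - DF z (z' - z)) \<le> norm (z' - z) * \<epsilon>"
      by (rule differentiable_bound_linearization[where S="Z \<inter> ball z d" and f'="DF"])
         (use seg z d on nz in \<open>auto intro!: has_derivative_at_withinI F_has_derivative simp: dist_commute\<close>)
    then show "norm (F z' - F z - DF z (z' - z)) \<le> \<epsilon> * norm (z' - z)" by (simp add: mult.commute)
  qed
qed

text \<open>Lower bound for the quotient equation tested with \<eta>^2 W, whose gradient is the
  vector paired with \<open>P\<close>. Half of the ellipticity \<nu> absorbs the linearisation
  error, and half of the rest absorbs the cross term with the cut-off gradient.\<close>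

lemma caccioppoli_pointwise:
  fixes z gW g\<eta> P :: "'v::euclidean_space"
  assumes z: "z \<noteq> 0" "\<nu> \<le> ell z" "0 < \<nu>" "\<nu> \<le> 2" and L: "1 \<le> L"
    and DFb: "norm (DF z gW) \<le> L * norm gW"
    and P: "norm (P - DF z gW) \<le> \<nu> / 2 * norm gW"
    and b: "\<bar>\<eta>\<bar> \<le> 1" "\<bar>W\<bar> \<le> L" "norm g\<eta> \<le> L" "\<bar>S\<bar> \<le> L"
  shows "\<nu> / 4 * (\<eta>\<^sup>2 * (norm gW)\<^sup>2) - (16 * L^6 / \<nu> + L^2)
      \<le> P \<bullet> (\<eta>\<^sup>2 *\<^sub>R gW + (2 * \<eta> * W) *\<^sub>R g\<eta>) + S * (\<eta>\<^sup>2 * W)"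
proof -
  define p where "p = \<bar>\<eta>\<bar> * norm gW"
  have p2: "\<eta>\<^sup>2 * (norm gW)\<^sup>2 = p\<^sup>2" by (simp add: p_def power_mult_distrib)
  have p0: "p \<ge> 0" by (simp add: p_def)
  have "\<nu> * (norm gW)\<^sup>2 \<le> DF z gW \<bullet> gW"
    using DF_lower[OF z(1), of gW] z(2) by (smt (verit) mult_right_mono zero_le_power2)
  moreover have "\<bar>(P - DF z gW) \<bullet> gW\<bar> \<le> \<nu> / 2 * (norm gW)\<^sup>2"
    using order_trans[OF Cauchy_Schwarz_ineq2 mult_right_mono[OF P norm_ge_zero]]
    by (simp add: power2_eq_square mult.assoc)
  ultimately have 1: "\<nu> / 2 * (norm gW)\<^sup>2 \<le> P \<bullet> gW"
    unfolding inner_diff_left abs_le_iff by linarith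
  have 1: "\<nu> / 2 * p\<^sup>2 \<le> \<eta>\<^sup>2 * (P \<bullet> gW)"
    using mult_left_mono[OF 1, of "\<eta>\<^sup>2"] by (simp add: p2[symmetric] mult_ac)
  have "norm P \<le> norm (P - DF z gW) + norm (DF z gW)" using norm_triangle_ineq[of "P - DF z gW" "DF z gW"] by simp
  also have "\<dots> \<le> 2 * L * norm gW"
    using P DFb mult_right_mono[of "\<nu>/2" L "norm gW"] z L by simp
  finally have nP: "norm P \<le> 2 * L * norm gW" .
  have "\<bar>(2 * \<eta> * W) * (P \<bullet> g\<eta>)\<bar> \<le> 2 * \<bar>\<eta>\<bar> * \<bar>W\<bar> * (norm P * norm g\<eta>)"
    by (simp add: abs_mult mult_left_mono Cauchy_Schwarz_ineq2)
  also have "\<dots> \<le> 2 * \<bar>\<eta>\<bar> * L * ((2 * L * norm gW) * L)"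
    using nP b L by (intro mult_mono) auto
  also have "\<dots> = 4 * L^3 * p" by (simp add: p_def power3_eq_cube)
  finally have 2: "\<bar>(2 * \<eta> * W) * (P \<bullet> g\<eta>)\<bar> \<le> 4 * L^3 * p" .
  have "\<bar>S * (\<eta>\<^sup>2 * W)\<bar> \<le> L * (1 * L)"
    unfolding abs_mult using b L by (intro mult_mono) (auto simp: power_le_one_iff abs_square_le_1)
  then have 3: "\<bar>S * (\<eta>\<^sup>2 * W)\<bar> \<le> L^2" by (simp add: power2_eq_square)
  have 4: "\<nu> / 4 * p\<^sup>2 - 16 * L^6 / \<nu> \<le> \<nu> / 2 * p\<^sup>2 - 4 * L^3 * p"
  proof -
    \<comment> \<open>Young's inequality as a completed square; it fixes the constant 16 L^6 /
      \<nu>.\<close>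
    have "0 \<le> (\<nu> * p / 2 - 4 * L^3)\<^sup>2 / \<nu>" using z by simp
    also have "(\<nu> * p / 2 - 4 * L^3)\<^sup>2 / \<nu> = \<nu> / 4 * p\<^sup>2 - 4 * L^3 * p + 16 * L^6 / \<nu>"
      using z by (simp add: field_simps power2_eq_square power3_eq_cube eval_nat_numeral)
    finally show ?thesis by simp
  qed
  have "P \<bullet> (\<eta>\<^sup>2 *\<^sub>R gW + (2 * \<eta> * W) *\<^sub>R g\<eta>) = \<eta>\<^sup>2 * (P \<bullet> gW) + (2 * \<eta> * W) * (P \<bullet> g\<eta>)"
    by (simp add: inner_add_right)
  with 1 2 3 4 show ?thesis unfolding p2 by linarith
qed

text \<open>The last vector is the gradient of \<open>\<eta>\<^sup>2 W\<^sup>2 / H\<close>, with \<open>gW\<close>, \<open>gH\<close>, \<open>g\<eta>\<close> the gradients of \<open>W\<close>, \<open>H\<close>, \<open>\<eta>\<close>, and \<open>Y\<close> is \<open>H \<nabla>(W/H)\<close>.\<close>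

lemma picone_pointwise:
  fixes z gW gH g\<eta> PW PH :: "'v::euclidean_space"
  assumes z: "z \<noteq> 0" and L: "1 \<le> L" "M * a (norm z) \<le> L"
    and s: "W = s * H" "\<bar>s\<bar> \<le> L" "\<bar>W\<bar> \<le> L"
    and \<eta>: "\<bar>\<eta>\<bar> \<le> 1" "norm g\<eta> \<le> L" and \<epsilon>: "0 \<le> \<epsilon>"
    and PW: "norm (PW - DF z gW) \<le> \<epsilon> * norm gW"
    and PH: "norm (PH - DF z gH) \<le> \<epsilon> * norm gH"
    and SW: "\<bar>SW - \<kappa> * W\<bar> \<le> \<epsilon>" and SH: "\<bar>SH - \<kappa> * H\<bar> \<le> \<epsilon>" and Ww: "\<bar>W\<^sup>2 - w\<^sup>2\<bar> \<le> \<epsilon>"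
  defines "Y \<equiv> gW - s *\<^sub>R gH"
  shows "\<eta>\<^sup>2 * (DF z Y \<bullet> Y) / 2 - 2 * M * a (norm z) * w\<^sup>2 * (norm g\<eta>)\<^sup>2
        - \<epsilon> * (10 * L^6) * (\<eta>\<^sup>2 * (norm gW)\<^sup>2 + \<eta>\<^sup>2 * (norm gH)\<^sup>2 + 1)
     \<le> PW \<bullet> (\<eta>\<^sup>2 *\<^sub>R gW + (2 * \<eta> * W) *\<^sub>R g\<eta>) + SW * (\<eta>\<^sup>2 * W)
       - (PH \<bullet> ((2 * \<eta> * s * W) *\<^sub>R g\<eta> + (2 * \<eta>\<^sup>2 * s) *\<^sub>R gW - (\<eta>\<^sup>2 * s\<^sup>2) *\<^sub>R gH) + SH * (\<eta>\<^sup>2 * s * W))"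
proof -
  define p q where "p = \<bar>\<eta>\<bar> * norm gW" and "q = \<bar>\<eta>\<bar> * norm gH"
  have p2: "\<eta>\<^sup>2 * (norm gW)\<^sup>2 = p\<^sup>2" "\<eta>\<^sup>2 * (norm gH)\<^sup>2 = q\<^sup>2" by (simp_all add: p_def q_def power_mult_distrib)
  have p0: "p \<ge> 0" "q \<ge> 0" by (simp_all add: p_def q_def)
  define EW EH where "EW = PW - DF z gW" and "EH = PH - DF z gH"
  define g1 g2 where "g1 = \<eta>\<^sup>2 *\<^sub>R gW + (2 * \<eta> * W) *\<^sub>R g\<eta>"
    and "g2 = (2 * \<eta> * s * W) *\<^sub>R g\<eta> + (2 * \<eta>\<^sup>2 * s) *\<^sub>R gW - (\<eta>\<^sup>2 * s\<^sup>2) *\<^sub>R gH"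
  \<comment> \<open>Picone's identity: by symmetry of \<open>DF z\<close> the terms free of
    \<open>g\<eta>\<close> combine into the quadratic form at \<open>Y\<close>, and a single cross
    term with the cut-off remains.\<close>
  have main: "DF z gW \<bullet> g1 - DF z gH \<bullet> g2 = \<eta>\<^sup>2 * (DF z Y \<bullet> Y) + 2 * \<eta> * W * (DF z Y \<bullet> g\<eta>)"
    unfolding g1_def g2_def Y_def DF_diff DF_scale
    by (simp add: inner_add_right inner_diff_right inner_diff_left DF_sym[of z gH gW] power2_eq_square algebra_simps)
  \<comment> \<open>Nonnegativity of the form at this vector is Young's inequality for the cross
    term: half of the energy of \<open>Y\<close> is kept.\<close>
  define X where "X = \<eta> *\<^sub>R Y + (2 * W) *\<^sub>R g\<eta>"
  have "0 \<le> DF z X \<bullet> X" using z by (rule DF_nonneg)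
  also have "DF z X \<bullet> X = \<eta>\<^sup>2 * (DF z Y \<bullet> Y) + 4 * \<eta> * W * (DF z Y \<bullet> g\<eta>) + 4 * W\<^sup>2 * (DF z g\<eta> \<bullet> g\<eta>)"
    unfolding X_def DF_add DF_scale
    by (simp add: inner_add_right inner_add_left DF_sym[of z g\<eta> Y] power2_eq_square algebra_simps)
  finally have main2: "\<eta>\<^sup>2 * (DF z Y \<bullet> Y) / 2 - 2 * W\<^sup>2 * (DF z g\<eta> \<bullet> g\<eta>) \<le> DF z gW \<bullet> g1 - DF z gH \<bullet> g2"
    unfolding main by simp
  have L1: "L^2 \<le> L^6" "L^4 \<le> L^6" "L^3 \<le> L^6" "L \<le> L^6" "1 \<le> L^6"
    using L(1) by (auto intro: power_increasing simp: self_le_power)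
  \<comment> \<open>In the application \<open>w\<close> is the exact directional derivative; trading
    W^2 for w^2 makes the cut-off term independent of the quotient, at the cost of \<epsilon>
    L^3.\<close>
  have up: "W\<^sup>2 * (DF z g\<eta> \<bullet> g\<eta>) \<le> M * a (norm z) * w\<^sup>2 * (norm g\<eta>)\<^sup>2 + \<epsilon> * L^3"
  proof -
    have "W\<^sup>2 * (DF z g\<eta> \<bullet> g\<eta>) \<le> W\<^sup>2 * (M * a (norm z) * (norm g\<eta>)\<^sup>2)"
      by (intro mult_left_mono DF_upper z) auto
    also have "\<dots> \<le> (w\<^sup>2 + \<epsilon>) * (M * a (norm z) * (norm g\<eta>)\<^sup>2)"
      using Ww M_ge1 a_pos[of "norm z"] z by (intro mult_right_mono mult_nonneg_nonneg) auto
    also have "\<dots> = M * a (norm z) * w\<^sup>2 * (norm g\<eta>)\<^sup>2 + \<epsilon> * (M * a (norm z) * (norm g\<eta>)\<^sup>2)"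
      by (simp add: algebra_simps)
    also have "\<epsilon> * (M * a (norm z) * (norm g\<eta>)\<^sup>2) \<le> \<epsilon> * (L * L\<^sup>2)"
      using L \<eta> \<epsilon> by (intro mult_left_mono mult_mono power_mono) auto
    finally show ?thesis by (simp add: power3_eq_cube power2_eq_square)
  qed
  \<comment> \<open>The linearisation error is proportional to |gW|, and so is the leading part of
    \<open>g1\<close>. The bound is therefore quadratic in the gradient, which is what Caccioppoli
    has to control.\<close>
  have eW: "\<bar>EW \<bullet> g1\<bar> \<le> \<epsilon> * (2 * p\<^sup>2 + L^4)"
  proof -
    have "\<bar>EW \<bullet> g1\<bar> \<le> norm EW * norm g1" by (rule Cauchy_Schwarz_ineq2)
    also have "\<dots> \<le> (\<epsilon> * norm gW) * (\<eta>\<^sup>2 * norm gW + 2 * \<bar>\<eta>\<bar> * L * L)"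
    proof (intro mult_mono)
      have "norm g1 \<le> \<eta>\<^sup>2 * norm gW + 2 * \<bar>\<eta>\<bar> * \<bar>W\<bar> * norm g\<eta>"
        unfolding g1_def by (rule norm_triangle_le) (simp add: abs_mult)
      also have "\<dots> \<le> \<eta>\<^sup>2 * norm gW + 2 * \<bar>\<eta>\<bar> * L * L"
        using s \<eta> L by (intro add_left_mono mult_mono) auto
      finally show "norm g1 \<le> \<eta>\<^sup>2 * norm gW + 2 * \<bar>\<eta>\<bar> * L * L" .
    qed (use PW \<epsilon> in \<open>auto simp: EW_def\<close>)
    also have "\<dots> = \<epsilon> * (p\<^sup>2 + 2 * p * L\<^sup>2)" by (simp add: p_def power2_eq_square algebra_simps)
    also have "\<dots> \<le> \<epsilon> * (2 * p\<^sup>2 + L^4)"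
    proof (intro mult_left_mono \<epsilon>)
      have "0 \<le> (p - L\<^sup>2)\<^sup>2" by simp
      also have "(p - L\<^sup>2)\<^sup>2 = p\<^sup>2 + L^4 - 2 * p * L\<^sup>2" by (simp add: power2_diff power_mult[symmetric] mult.assoc)
      finally show "p\<^sup>2 + 2 * p * L\<^sup>2 \<le> 2 * p\<^sup>2 + L^4" by simp
    qed
    finally show ?thesis .
  qed
  have eH: "\<bar>EH \<bullet> g2\<bar> \<le> \<epsilon> * (L * (p\<^sup>2 + q\<^sup>2) + L\<^sup>2 * q\<^sup>2 + q\<^sup>2 + L^6)"
  proof -
    have "\<bar>EH \<bullet> g2\<bar> \<le> norm EH * norm g2" by (rule Cauchy_Schwarz_ineq2)
    also have "\<dots> \<le> (\<epsilon> * norm gH) * (2 * \<bar>\<eta>\<bar> * L * L * L + 2 * \<eta>\<^sup>2 * L * norm gW + \<eta>\<^sup>2 * L\<^sup>2 * norm gH)"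
    proof (intro mult_mono)
      have "norm g2 \<le> norm ((2 * \<eta> * s * W) *\<^sub>R g\<eta>) + norm ((2 * \<eta>\<^sup>2 * s) *\<^sub>R gW) + norm ((\<eta>\<^sup>2 * s\<^sup>2) *\<^sub>R gH)"
        unfolding g2_def by (intro order_trans[OF norm_triangle_ineq4] add_mono norm_triangle_ineq order_refl)
      also have "\<dots> = 2 * \<bar>\<eta>\<bar> * \<bar>s\<bar> * \<bar>W\<bar> * norm g\<eta> + 2 * \<eta>\<^sup>2 * \<bar>s\<bar> * norm gW + \<eta>\<^sup>2 * \<bar>s\<bar>\<^sup>2 * norm gH"
        by (simp add: abs_mult)
      also have "\<dots> \<le> 2 * \<bar>\<eta>\<bar> * L * L * L + 2 * \<eta>\<^sup>2 * L * norm gW + \<eta>\<^sup>2 * L\<^sup>2 * norm gH"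
        using s \<eta> L
        by (intro add_mono mult_mono[of "2 * \<bar>\<eta>\<bar> * \<bar>s\<bar> * \<bar>W\<bar>"] mult_mono[of "2 * \<bar>\<eta>\<bar> * \<bar>s\<bar>"]
            mult_mono[of "2 * \<bar>\<eta>\<bar>"] mult_right_mono mult_left_mono power_mono[of "\<bar>s\<bar>"]) auto
      finally show "norm g2 \<le> 2 * \<bar>\<eta>\<bar> * L * L * L + 2 * \<eta>\<^sup>2 * L * norm gW + \<eta>\<^sup>2 * L\<^sup>2 * norm gH" .
    qed (use PH \<epsilon> in \<open>auto simp: EH_def\<close>)
    also have "\<dots> = \<epsilon> * (2 * q * L^3 + L * (2 * p * q) + L\<^sup>2 * q\<^sup>2)"
      by (simp add: p_def q_def power2_eq_square power3_eq_cube algebra_simps)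
    also have "\<dots> \<le> \<epsilon> * (L * (p\<^sup>2 + q\<^sup>2) + L\<^sup>2 * q\<^sup>2 + q\<^sup>2 + L^6)"
    proof (intro mult_left_mono \<epsilon>)
      have "0 \<le> (q - L^3)\<^sup>2" by simp
      also have "(q - L^3)\<^sup>2 = q\<^sup>2 + L^6 - 2 * q * L^3" by (simp add: power2_diff power_mult[symmetric] mult.assoc)
      finally have 1: "2 * q * L^3 \<le> q\<^sup>2 + L^6" by simp
      have "L * (2 * p * q) \<le> L * (p\<^sup>2 + q\<^sup>2)"
        using L sum_squares_bound[of p q] by (intro mult_left_mono) auto
      with 1 show "2 * q * L^3 + L * (2 * p * q) + L\<^sup>2 * q\<^sup>2 \<le> L * (p\<^sup>2 + q\<^sup>2) + L\<^sup>2 * q\<^sup>2 + q\<^sup>2 + L^6"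
        by linarith
    qed
    finally show ?thesis .
  qed
  have eS: "\<bar>SW * (\<eta>\<^sup>2 * W) - SH * (\<eta>\<^sup>2 * s * W)\<bar> \<le> \<epsilon> * (L + L\<^sup>2)"
  proof -
    \<comment> \<open>Because s H = W and both equations share \<kappa>, its contributions cancel
      exactly and only the \<epsilon> errors survive.\<close>
    have "SW * (\<eta>\<^sup>2 * W) - SH * (\<eta>\<^sup>2 * s * W) = (\<eta>\<^sup>2 * W) * ((SW - \<kappa> * W) - s * (SH - \<kappa> * H))"
      using s(1) by (simp add: algebra_simps)
    also have "\<bar>\<dots>\<bar> \<le> (1 * L) * (\<epsilon> + L * \<epsilon>)"
      unfolding abs_mult
    proof (intro mult_mono)
      have "\<bar>s * (SH - \<kappa> * H)\<bar> \<le> L * \<epsilon>" unfolding abs_mult using s SH L by (intro mult_mono) auto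
      then show "\<bar>SW - \<kappa> * W - s * (SH - \<kappa> * H)\<bar> \<le> \<epsilon> + L * \<epsilon>" using SW by linarith
    qed (use s \<eta> L \<epsilon> in \<open>auto simp: abs_square_le_1\<close>)
    finally show ?thesis by (simp add: algebra_simps power2_eq_square)
  qed
  have PWe: "PW = DF z gW + EW" "PH = DF z gH + EH" by (simp_all add: EW_def EH_def)
  have split: "PW \<bullet> g1 + SW * (\<eta>\<^sup>2 * W) - (PH \<bullet> g2 + SH * (\<eta>\<^sup>2 * s * W))
      = (DF z gW \<bullet> g1 - DF z gH \<bullet> g2) + EW \<bullet> g1 - EH \<bullet> g2 + (SW * (\<eta>\<^sup>2 * W) - SH * (\<eta>\<^sup>2 * s * W))"
    unfolding PWe by (simp add: inner_add_left)
  \<comment> \<open>Every power of L is raised to L^6; all resulting coefficients stay below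
    10.\<close>
  have tot: "2 * L^3 + (2 * p\<^sup>2 + L^4) + (L * (p\<^sup>2 + q\<^sup>2) + L\<^sup>2 * q\<^sup>2 + q\<^sup>2 + L^6) + (L + L\<^sup>2)
      \<le> (10 * L^6) * (p\<^sup>2 + q\<^sup>2 + 1)"
  proof -
    have "1 * p\<^sup>2 \<le> L^6 * p\<^sup>2" "L * (p\<^sup>2 + q\<^sup>2) \<le> L^6 * (p\<^sup>2 + q\<^sup>2)" "L\<^sup>2 * q\<^sup>2 \<le> L^6 * q\<^sup>2" "1 * q\<^sup>2 \<le> L^6 * q\<^sup>2"
      by (intro mult_right_mono L1 add_nonneg_nonneg zero_le_power2)+
    moreover have "0 \<le> L^6 * p\<^sup>2" "0 \<le> L^6 * q\<^sup>2" using L by auto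
    ultimately show ?thesis
      using L1 unfolding distrib_left mult_1_left mult_1_right by linarith
  qed
  have "\<epsilon> * (2 * L^3) + \<epsilon> * (2 * p\<^sup>2 + L^4) + \<epsilon> * (L * (p\<^sup>2 + q\<^sup>2) + L\<^sup>2 * q\<^sup>2 + q\<^sup>2 + L^6) + \<epsilon> * (L + L\<^sup>2)
      \<le> \<epsilon> * (10 * L^6) * (p\<^sup>2 + q\<^sup>2 + 1)"
    using mult_left_mono[OF tot \<epsilon>] by (simp only: distrib_left mult.assoc)
  then show ?thesis
    using main2 up eW eH eS unfolding g1_def[symmetric] g2_def[symmetric] split p2
    by (simp add: abs_le_iff)
qed

end

section \<open>Difference quotients of a monotone solution\<close>

lemma segment_in_cball:
  fixes x v :: "'a::real_normed_vector"
  assumes "x \<in> cball 0 R" "0 \<le> t" "t \<le> 1" "norm v \<le> 1"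
  shows "x + t *\<^sub>R v \<in> cball 0 (R + 1)"
proof -
  have "norm (t *\<^sub>R v) \<le> 1 * 1" unfolding norm_scaleR using assms by (intro mult_mono) auto
  then show ?thesis using assms(1) norm_triangle_ineq[of x "t *\<^sub>R v"] by simp
qed

lemma directional_MVT:
  fixes g :: "'a::real_inner \<Rightarrow> real"
  assumes g: "\<And>x. (g has_derivative (\<lambda>h. gg x \<bullet> h)) (at x)" and t: "0 < t"
  obtains s where "0 < s" "s < t" "g (x + t *\<^sub>R v) - g x = t * (gg (x + s *\<^sub>R v) \<bullet> v)"
proof -
  have "((\<lambda>s. g (x + s *\<^sub>R v)) has_real_derivative gg (x + s *\<^sub>R v) \<bullet> v) (at s)" for s
  proof -
    have "((\<lambda>s. g (x + s *\<^sub>R v)) has_derivative (\<lambda>h. gg (x + s *\<^sub>R v) \<bullet> (h *\<^sub>R v))) (at s)"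
      by (rule has_derivative_compose[OF _ g]) (auto intro!: derivative_eq_intros)
    then show ?thesis
      by (rule has_derivative_imp_has_field_derivative) simp
  qed
  then obtain s where "0 < s" "s < t"
      "g (x + t *\<^sub>R v) - g (x + 0 *\<^sub>R v) = (t - 0) * (gg (x + s *\<^sub>R v) \<bullet> v)"
    using MVT2[of 0 t "\<lambda>s. g (x + s *\<^sub>R v)" "\<lambda>s. gg (x + s *\<^sub>R v) \<bullet> v"] t by auto
  then show ?thesis using that by simp
qed

text \<open>The mean value theorem turns the quotient into the gradient at a point of the segment.
  Uniform continuity is taken on a ball with radius enlarged by 1, which contains the segment once t
  < 1.\<close>

lemma difference_quotient_uniform:
  fixes g :: "'a::euclidean_space \<Rightarrow> real"
  assumes g: "\<And>x. (g has_derivative (\<lambda>h. gg x \<bullet> h)) (at x)" and c: "continuous_on UNIV gg"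
    and v: "norm v \<le> 1" and \<epsilon>: "0 < \<epsilon>"
  shows "\<forall>\<^sub>F t in at_right 0. \<forall>x\<in>cball 0 R. \<bar>(g (x + t *\<^sub>R v) - g x) / t - gg x \<bullet> v\<bar> < \<epsilon>"
proof -
  have "uniformly_continuous_on (cball 0 (R + 1)) gg"
    by (intro compact_uniformly_continuous continuous_on_subset[OF c]) auto
  then obtain d where d: "d > 0" "\<And>x y. x \<in> cball 0 (R+1) \<Longrightarrow> y \<in> cball 0 (R+1) \<Longrightarrow> dist y x < d \<Longrightarrow> dist (gg y) (gg x) < \<epsilon>"
    using \<epsilon> unfolding uniformly_continuous_on_def by metis
  have "\<forall>\<^sub>F t in at_right 0. 0 < t \<and> t < min d 1"
    using d by (auto simp: eventually_at_right_field intro!: exI[of _ "min d 1"])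
  then show ?thesis
  proof eventually_elim
    fix t :: real assume t: "0 < t \<and> t < min d 1"
    show "\<forall>x\<in>cball 0 R. \<bar>(g (x + t *\<^sub>R v) - g x) / t - gg x \<bullet> v\<bar> < \<epsilon>"
    proof
      fix x :: 'a assume x: "x \<in> cball 0 R"
      obtain s where s: "0 < s" "s < t" "g (x + t *\<^sub>R v) - g x = t * (gg (x + s *\<^sub>R v) \<bullet> v)"
        using directional_MVT[OF g, of t x v] t by auto
      have "(g (x + t *\<^sub>R v) - g x) / t - gg x \<bullet> v = (gg (x + s *\<^sub>R v) - gg x) \<bullet> v"
        using s t by (simp add: inner_diff_left)
      also have "\<bar>\<dots>\<bar> \<le> norm (gg (x + s *\<^sub>R v) - gg x) * norm v" by (rule Cauchy_Schwarz_ineq2)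
      also have "\<dots> \<le> norm (gg (x + s *\<^sub>R v) - gg x) * 1" by (intro mult_left_mono v) auto
      also have "\<dots> < \<epsilon>"
      proof -
        have "norm (s *\<^sub>R v) \<le> s * 1" unfolding norm_scaleR using s v by (intro mult_mono) auto
        then have "norm (s *\<^sub>R v) < d" using s t by linarith
        then have "dist (x + s *\<^sub>R v) x < d" by (simp add: dist_norm)
        moreover have "x + s *\<^sub>R v \<in> cball 0 (R + 1)" using s t x v by (intro segment_in_cball) auto
        ultimately show ?thesis using d(2)[of x "x + s *\<^sub>R v"] x by (simp add: dist_norm)
      qed
      finally show "\<bar>(g (x + t *\<^sub>R v) - g x) / t - gg x \<bullet> v\<bar> < \<epsilon>" .
    qed
  qed
qed

lemma small_shift_uniform:
  fixes g :: "'a::euclidean_space \<Rightarrow> 'b::metric_space"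
  assumes c: "continuous_on UNIV g" and v: "norm v \<le> 1" and \<epsilon>: "0 < \<epsilon>"
  shows "\<forall>\<^sub>F t in at_right 0. \<forall>x\<in>cball 0 R. dist (g (x + t *\<^sub>R v)) (g x) < \<epsilon>"
proof -
  have "uniformly_continuous_on (cball 0 (R + 1)) g"
    by (intro compact_uniformly_continuous continuous_on_subset[OF c]) auto
  then obtain d where d: "d > 0" "\<And>x y. x \<in> cball 0 (R+1) \<Longrightarrow> y \<in> cball 0 (R+1) \<Longrightarrow> dist y x < d \<Longrightarrow> dist (g y) (g x) < \<epsilon>"
    using \<epsilon> unfolding uniformly_continuous_on_def by metis
  have "\<forall>\<^sub>F t in at_right 0. 0 < t \<and> t < min d 1"
    using d by (auto simp: eventually_at_right_field intro!: exI[of _ "min d 1"])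
  then show ?thesis
  proof eventually_elim
    fix t :: real assume t: "0 < t \<and> t < min d 1"
    show "\<forall>x\<in>cball 0 R. dist (g (x + t *\<^sub>R v)) (g x) < \<epsilon>"
    proof
      fix x :: 'a assume x: "x \<in> cball 0 R"
      have "norm (t *\<^sub>R v) \<le> t * 1" unfolding norm_scaleR using t v by (intro mult_mono) auto
      then have "norm (t *\<^sub>R v) < d" using t by linarith
      then have "dist (x + t *\<^sub>R v) x < d" by (simp add: dist_norm)
      moreover have "x + t *\<^sub>R v \<in> cball 0 (R + 1)" using t x v by (intro segment_in_cball) auto
      ultimately show "dist (g (x + t *\<^sub>R v)) (g x) < \<epsilon>" using d(2)[of x "x + t *\<^sub>R v"] x by simp
    qed
  qed
qed

lemma support_gradient_zero:
  fixes \<phi> :: "'a::euclidean_space \<Rightarrow> real"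
  assumes "\<And>x. (\<phi> has_derivative (\<lambda>h. g x \<bullet> h)) (at x)"
    and "\<And>x. norm x > R \<Longrightarrow> \<phi> x = 0" and "norm x > R"
  shows "g x = 0"
proof -
  have "((\<lambda>x. 0::real) has_derivative (\<lambda>h. g x \<bullet> h)) (at x)"
  proof (rule has_derivative_transform_within_open[OF assms(1)])
    show "open (- cball 0 R :: 'a set)" by auto
  qed (use assms in auto)
  then have "(\<lambda>h. g x \<bullet> h) = (\<lambda>h. 0)"
    using has_derivative_unique has_derivative_const by blast
  then have "g x \<bullet> g x = 0" by metis
  then show ?thesis by simp
qed

text \<open>The setting shared by all the model coefficients. Strict monotonicity along
  \<open>e\<close> confines the gradient to an open half-space, hence away from the singularity of
  the flux at 0. Growth and boundedness are imposed lemma by lemma.\<close>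

locale monotone_solution = elliptic +
  fixes u :: "real ^ 'n \<Rightarrow> real" and f f' :: "real \<Rightarrow> real" and e :: "real ^ 'n"
  assumes C1u: "C1 u"
    and f_deriv: "\<And>s. (f has_real_derivative f' s) (at s)"
    and f'_cont: "continuous_on UNIV f'"
    and e_unit: "norm e = 1"
    and monotone: "\<And>x. 0 < gradient u x \<bullet> e"
    and weak: "\<And>\<phi>. C1_compact_support \<phi> \<Longrightarrow>
        (\<integral>x. (a (norm (gradient u x)) *\<^sub>R gradient u x) \<bullet> gradient \<phi> x - f (u x) * \<phi> x \<partial>\<mu>) = 0"
begin

abbreviation "gu \<equiv> gradient u"

definition "D t v x = (u (x + t *\<^sub>R v) - u x) / t"
definition "gD t v x = (1 / t) *\<^sub>R (gu (x + t *\<^sub>R v) - gu x)"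
definition "P t v x = (1 / t) *\<^sub>R (F (gu (x + t *\<^sub>R v)) - F (gu x))"
text \<open>The first term comes from differencing the Gaussian weight, the second from differencing
  f(u).\<close>

definition "S t v x = v \<bullet> F (gu (x + t *\<^sub>R v)) - (f (u (x + t *\<^sub>R v)) - f (u x)) / t"
text \<open>Coefficient in the limit of \<open>S\<close>: the weight term tends to a(|\<nabla>u|)
  \<partial>_v u and the quotient of f(u) to f'(u) \<partial>_v u, so the direction factors
  out.\<close>

definition "\<kappa> x = a (norm (gu x)) - f' (u x)"

lemma gu_nz [simp]: "gu x \<noteq> 0"
  using monotone[of x] by auto

lemma u_deriv: "(u has_derivative (\<lambda>h. gu x \<bullet> h)) (at x)"
  by (rule C1_has_derivative[OF C1u])

lemma continuous_on_f: "continuous_on A f"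
  using f_deriv DERIV_isCont by (intro continuous_at_imp_continuous_on) auto

lemma continuous_on_u: "continuous_on A u"
  by (rule has_derivative_continuous_on[OF has_derivative_at_withinI[OF u_deriv]])

lemma continuous_on_gu: "continuous_on A gu"
  using C1u unfolding C1_def by (auto intro: continuous_on_subset)

lemma continuous_on_u_compose [continuous_intros]:
  assumes "continuous_on A g"
  shows "continuous_on A (\<lambda>x. u (g x))" "continuous_on A (\<lambda>x. gu (g x))"
  using assms continuous_on_compose2[OF continuous_on_u[of UNIV]]
    continuous_on_compose2[OF continuous_on_gu[of UNIV]] by auto

lemma continuous_on_f_compose [continuous_intros]:
  assumes "continuous_on A g"
  shows "continuous_on A (\<lambda>x. f (g x))" "continuous_on A (\<lambda>x. f' (g x))"
  using assms continuous_on_compose2[OF continuous_on_f[of UNIV]]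
    continuous_on_compose2[OF f'_cont] by auto

lemma continuous_on_quotients [continuous_intros]:
  "continuous_on A (D t v)" "continuous_on A (gD t v)" "continuous_on A (P t v)" "continuous_on A (S t v)"
  if "t \<noteq> 0"
  unfolding D_def gD_def P_def S_def using that by (auto intro!: continuous_intros)

lemma continuous_on_kappa [continuous_intros]: "continuous_on A \<kappa>"
  unfolding \<kappa>_def by (auto intro!: continuous_intros)

section \<open>The equation satisfied by difference quotients\<close>

lemma weak_lborel:
  assumes "\<And>x. (\<phi> has_derivative (\<lambda>h. g x \<bullet> h)) (at x)" "continuous_on UNIV g"
    and "\<And>x. norm x > R \<Longrightarrow> \<phi> x = 0"
  shows "(\<integral>x. rho x * (F (gu x) \<bullet> g x - f (u x) * \<phi> x) \<partial>lborel) = 0"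
proof -
  have c\<phi>: "continuous_on UNIV \<phi>"
    by (rule has_derivative_continuous_on[OF has_derivative_at_withinI[OF assms(1)]])
  have "(\<integral>x. F (gu x) \<bullet> g x - f (u x) * \<phi> x \<partial>\<mu>) = 0"
    using weak[OF C1_compact_supportI(1)[OF assms]] C1_compact_supportI(2)[OF assms]
    by (simp add: F_def)
  moreover have "(\<lambda>x. F (gu x) \<bullet> g x - f (u x) * \<phi> x) \<in> borel_measurable borel"
    by (intro borel_measurable_continuous_onI continuous_intros assms(2) c\<phi>) auto
  ultimately show ?thesis by (simp add: integral_mu)
qed

text \<open>Translating a test function does not preserve the Gaussian weight; the correction factor produces the term \<open>\<phi> x *\<^sub>R y\<close>.\<close>

lemma weak_shifted:
  assumes d: "\<And>x. (\<phi> has_derivative (\<lambda>h. g x \<bullet> h)) (at x)" and c: "continuous_on UNIV g"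
    and s: "\<And>x. norm x > R \<Longrightarrow> \<phi> x = 0"
  shows "(\<integral>x. rho x * (F (gu (x + y)) \<bullet> (g x + \<phi> x *\<^sub>R y) - f (u (x + y)) * \<phi> x) \<partial>lborel) = 0"
proof -
  have c\<phi>: "continuous_on UNIV \<phi>"
    by (rule has_derivative_continuous_on[OF has_derivative_at_withinI[OF d]])
  \<comment> \<open>The inverse of the factor in \<open>rho_shift\<close>: multiplying the
    translated test function by \<open>w\<close> turns \<open>rho x\<close> into
    \<open>rho (x - y)\<close>, and a change of variables then moves the translation onto
    \<open>u\<close>.\<close>
  define w where "w x = exp (y \<bullet> (x - y) + (norm y)\<^sup>2 / 2)" for x :: "real ^ 'n"
  have w: "rho x * w x = rho (x - y)" for x
    by (subst rho_shift[of x y]) (simp add: w_def exp_add[symmetric] exp_diff exp_minus field_simps)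
  have dw: "(w has_derivative (\<lambda>h. w x * (y \<bullet> h))) (at x)" for x
    unfolding w_def by (auto intro!: derivative_eq_intros)
  have d\<phi>: "((\<lambda>x. \<phi> (x - y)) has_derivative (\<lambda>h. g (x - y) \<bullet> h)) (at x)" for x
    by (rule has_derivative_compose[OF _ d]) (auto intro!: derivative_eq_intros)
  have "((\<lambda>x. w x * \<phi> (x - y)) has_derivative (\<lambda>h. (w x *\<^sub>R (g (x - y) + \<phi> (x - y) *\<^sub>R y)) \<bullet> h)) (at x)" for x
    by (rule has_derivative_eq_rhs[OF has_derivative_mult[OF dw d\<phi>]])
       (auto simp: inner_add_left algebra_simps)
  moreover have "continuous_on UNIV (\<lambda>x. w x *\<^sub>R (g (x - y) + \<phi> (x - y) *\<^sub>R y))"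
    unfolding w_def
    by (intro continuous_intros continuous_on_compose2[OF c] continuous_on_compose2[OF c\<phi>]) auto
  moreover have "w x * \<phi> (x - y) = 0" if "norm x > R + norm y" for x
    using s[of "x - y"] that norm_triangle_ineq2[of x y] by simp
  ultimately have "(\<integral>x. rho x * (F (gu x) \<bullet> (w x *\<^sub>R (g (x - y) + \<phi> (x - y) *\<^sub>R y)) - f (u x) * (w x * \<phi> (x - y))) \<partial>lborel) = 0"
    by (rule weak_lborel)
  also have "(\<lambda>x. rho x * (F (gu x) \<bullet> (w x *\<^sub>R (g (x - y) + \<phi> (x - y) *\<^sub>R y)) - f (u x) * (w x * \<phi> (x - y))))
      = (\<lambda>x. rho (x - y) * (F (gu x) \<bullet> (g (x - y) + \<phi> (x - y) *\<^sub>R y) - f (u x) * \<phi> (x - y)))"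
    by (auto simp: w[symmetric] algebra_simps)
  finally have *: "(\<integral>x. rho (x - y) * (F (gu x) \<bullet> (g (x - y) + \<phi> (x - y) *\<^sub>R y) - f (u x) * \<phi> (x - y)) \<partial>lborel) = 0" .
  have "(\<lambda>x. rho (x - y) * (F (gu x) \<bullet> (g (x - y) + \<phi> (x - y) *\<^sub>R y) - f (u x) * \<phi> (x - y))) \<in> borel_measurable borel"
    by (intro borel_measurable_continuous_onI continuous_intros continuous_on_compose2[OF c] continuous_on_compose2[OF c\<phi>]) auto
  from integral_lborel_shift[OF this, of y] * show ?thesis by simp
qed

text \<open>Subtract the shifted equations for y = t v and y = 0 and divide by t. The correction
  \<phi> y is itself of order t, so it leaves the undivided flux term in \<open>S\<close>.\<close>

lemma quotient_equation:
  assumes d: "\<And>x. (\<phi> has_derivative (\<lambda>h. g x \<bullet> h)) (at x)" and c: "continuous_on UNIV g"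
    and s: "\<And>x. norm x > R \<Longrightarrow> \<phi> x = 0" and t: "t \<noteq> 0"
  shows "(\<integral>x. rho x * (P t v x \<bullet> g x + S t v x * \<phi> x) \<partial>lborel) = 0"
    and "integrable lborel (\<lambda>x. rho x * (P t v x \<bullet> g x + S t v x * \<phi> x))"
proof -
  have c\<phi>: "continuous_on UNIV \<phi>"
    by (rule has_derivative_continuous_on[OF has_derivative_at_withinI[OF d]])
  have s': "norm x > R \<Longrightarrow> g x = 0" for x using support_gradient_zero[OF d s] by blast
  let ?I = "\<lambda>y x. rho x * (F (gu (x + y)) \<bullet> (g x + \<phi> x *\<^sub>R y) - f (u (x + y)) * \<phi> x)"
  have int: "integrable lborel (?I y)" for y
    using s s' by (intro integrable_continuous_compact_support[where R=R])
      (auto intro!: continuous_intros c c\<phi>)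
  have eq: "(\<lambda>x. rho x * (P t v x \<bullet> g x + S t v x * \<phi> x)) = (\<lambda>x. (1 / t) * (?I (t *\<^sub>R v) x - ?I 0 x))"
  proof
    fix x
    let ?A = "F (gu (x + t *\<^sub>R v))" and ?B = "F (gu x)"
    have p: "P t v x \<bullet> g x = (?A \<bullet> g x - ?B \<bullet> g x) / t"
      by (simp add: P_def inner_diff_left)
    have q: "?A \<bullet> (g x + \<phi> x *\<^sub>R (t *\<^sub>R v)) = ?A \<bullet> g x + t * \<phi> x * (v \<bullet> ?A)"
      by (simp add: inner_add_right inner_add_left inner_commute mult_ac)
    show "rho x * (P t v x \<bullet> g x + S t v x * \<phi> x) = (1 / t) * (?I (t *\<^sub>R v) x - ?I 0 x)"
      unfolding p q S_def using t by (simp add: field_simps)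
  qed
  show "integrable lborel (\<lambda>x. rho x * (P t v x \<bullet> g x + S t v x * \<phi> x))"
    unfolding eq using int by (intro integrable_mult_right Bochner_Integration.integrable_diff)
  have "(\<integral>x. (1 / t) * (?I (t *\<^sub>R v) x - ?I 0 x) \<partial>lborel) = (1 / t) * ((\<integral>x. ?I (t *\<^sub>R v) x \<partial>lborel) - (\<integral>x. ?I 0 x \<partial>lborel))"
    by (simp only: integral_mult_right_zero Bochner_Integration.integral_diff[OF int int])
  also have "\<dots> = 0" by (simp only: weak_shifted[OF d c s]) simp
  finally show "(\<integral>x. rho x * (P t v x \<bullet> g x + S t v x * \<phi> x) \<partial>lborel) = 0" unfolding eq .
qed

section \<open>Uniform limits of the quotients on balls\<close>

lemma D_limit:
  assumes "norm v \<le> 1" "0 < \<epsilon>"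
  shows "\<forall>\<^sub>F t in at_right 0. \<forall>x\<in>cball 0 R. \<bar>D t v x - gu x \<bullet> v\<bar> < \<epsilon>"
  unfolding D_def by (rule difference_quotient_uniform[OF u_deriv continuous_on_gu assms])

lemma bounded_on_cball:
  assumes "continuous_on UNIV (g :: real ^ 'n \<Rightarrow> 'b::real_normed_vector)"
  obtains B where "1 \<le> B" "\<And>x. x \<in> cball 0 R \<Longrightarrow> norm (g x) \<le> B"
proof -
  have "bounded (g ` cball 0 R)"
    by (intro compact_imp_bounded compact_continuous_image continuous_on_subset[OF assms]) auto
  then obtain B where "\<forall>x\<in>cball 0 R. norm (g x) \<le> B" by (auto simp: bounded_iff)
  then show ?thesis using that[of "max 1 B"] by (simp add: le_max_iff_disj)
qed

text \<open>Three errors of size \<epsilon>/3: shifting the flux, differencing f(u), and replacing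
  \<partial>_v u by \<open>D\<close>. The last one is multiplied by \<kappa>, hence the local bound
  \<open>B\<close>.\<close>

lemma S_limit:
  assumes v: "norm v \<le> 1" and \<epsilon>: "0 < \<epsilon>"
  shows "\<forall>\<^sub>F t in at_right 0. \<forall>x\<in>cball 0 R. \<bar>S t v x - \<kappa> x * D t v x\<bar> < \<epsilon>"
proof -
  obtain B where B: "1 \<le> B" "\<And>x. x \<in> cball 0 R \<Longrightarrow> norm (\<kappa> x) \<le> B"
    using bounded_on_cball[OF continuous_on_kappa] by blast
  have fu: "((\<lambda>x. f (u x)) has_derivative (\<lambda>h. (f' (u x) *\<^sub>R gu x) \<bullet> h)) (at x)" for x
    using has_derivative_compose[OF u_deriv f_deriv[THEN has_field_derivative_imp_has_derivative]]
    by (simp add: mult.commute)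
  have 1: "\<forall>\<^sub>F t in at_right 0. \<forall>x\<in>cball 0 R. \<bar>(f (u (x + t *\<^sub>R v)) - f (u x)) / t - (f' (u x) *\<^sub>R gu x) \<bullet> v\<bar> < \<epsilon> / 3"
    by (rule difference_quotient_uniform[OF fu _ v]) (use \<epsilon> in \<open>auto intro!: continuous_intros\<close>)
  have 2: "\<forall>\<^sub>F t in at_right 0. \<forall>x\<in>cball 0 R. dist (F (gu (x + t *\<^sub>R v))) (F (gu x)) < \<epsilon> / 3"
    by (rule small_shift_uniform[OF _ v]) (use \<epsilon> in \<open>auto intro!: continuous_intros\<close>)
  have 3: "\<forall>\<^sub>F t in at_right 0. \<forall>x\<in>cball 0 R. \<bar>D t v x - gu x \<bullet> v\<bar> < \<epsilon> / (3 * B)"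
    using \<epsilon> B(1) by (intro D_limit v) auto
  from 1 2 3 show ?thesis
  proof eventually_elim
    case (elim t)
    show ?case
    proof
      fix x :: "real ^ 'n" assume x: "x \<in> cball 0 R"
      have "\<bar>v \<bullet> (F (gu (x + t *\<^sub>R v)) - F (gu x))\<bar> \<le> 1 * norm (F (gu (x + t *\<^sub>R v)) - F (gu x))"
        by (rule order_trans[OF Cauchy_Schwarz_ineq2 mult_right_mono[OF v]]) simp
      also have "\<dots> < \<epsilon> / 3" using elim(2) x by (simp add: dist_norm)
      finally have a: "\<bar>v \<bullet> F (gu (x + t *\<^sub>R v)) - a (norm (gu x)) * (gu x \<bullet> v)\<bar> < \<epsilon> / 3"
        by (simp add: inner_diff_right F_def inner_commute)
      have "\<bar>\<kappa> x * (D t v x - gu x \<bullet> v)\<bar> \<le> B * \<bar>D t v x - gu x \<bullet> v\<bar>"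
        unfolding abs_mult using B(2)[OF x] by (intro mult_right_mono) auto
      also have "\<dots> < B * (\<epsilon> / (3 * B))" using elim(3) x B(1) by (intro mult_strict_left_mono) auto
      finally have b: "\<bar>\<kappa> x * (D t v x - gu x \<bullet> v)\<bar> < \<epsilon> / 3" using B(1) by simp
      have c: "\<bar>(f (u (x + t *\<^sub>R v)) - f (u x)) / t - f' (u x) * (gu x \<bullet> v)\<bar> < \<epsilon> / 3"
        using elim(1) x by simp
      have "S t v x - \<kappa> x * D t v x = (v \<bullet> F (gu (x + t *\<^sub>R v)) - a (norm (gu x)) * (gu x \<bullet> v))
          - ((f (u (x + t *\<^sub>R v)) - f (u x)) / t - f' (u x) * (gu x \<bullet> v)) - \<kappa> x * (D t v x - gu x \<bullet> v)"
        by (simp add: S_def \<kappa>_def algebra_simps)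
      with a b c show "\<bar>S t v x - \<kappa> x * D t v x\<bar> < \<epsilon>" by linarith
    qed
  qed
qed

text \<open>The error has to be relative to \<open>gD\<close>: with u only C1, no pointwise bound on
  \<open>gD\<close> is available as t tends to 0.\<close>

lemma P_limit:
  assumes v: "norm v \<le> 1" and \<epsilon>: "0 < \<epsilon>"
  shows "\<forall>\<^sub>F t in at_right 0. \<forall>x\<in>cball 0 R. norm (P t v x - DF (gu x) (gD t v x)) \<le> \<epsilon> * norm (gD t v x)"
proof -
  define Z where "Z = convex hull (gu ` cball 0 (R + 1))"
  have "compact Z"
    unfolding Z_def by (intro compact_convex_hull compact_continuous_image continuous_on_gu) auto
  moreover have "convex Z" by (simp add: Z_def)
  \<comment> \<open>This half-space is convex, so even the hull of the gradients avoids 0.\<close>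
  moreover have "Z \<subseteq> {z. e \<bullet> z > 0}"
    unfolding Z_def using monotone by (intro hull_minimal convex_halfspace_gt) (auto simp: inner_commute)
  then have "0 \<notin> Z" by auto
  ultimately obtain d where d: "d > 0" "\<And>z z'. z \<in> Z \<Longrightarrow> z' \<in> Z \<Longrightarrow> norm (z' - z) < d \<Longrightarrow>
           norm (F z' - F z - DF z (z' - z)) \<le> \<epsilon> * norm (z' - z)"
    using F_uniform_linearization[of Z \<epsilon>] \<epsilon> by metis
  have in_Z: "x \<in> cball 0 (R + 1) \<Longrightarrow> gu x \<in> Z" for x
    unfolding Z_def by (intro hull_inc) auto
  have "\<forall>\<^sub>F t in at_right 0. \<forall>x\<in>cball 0 R. dist (gu (x + t *\<^sub>R v)) (gu x) < d"
    by (rule small_shift_uniform[OF continuous_on_gu v d(1)])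
  moreover have "\<forall>\<^sub>F t in at_right 0. 0 < t \<and> t < (1::real)"
    by (auto simp: eventually_at_right_field intro!: exI[of _ 1])
  ultimately show ?thesis
  proof eventually_elim
    case (elim t)
    show ?case
    proof
      fix x :: "real ^ 'n" assume x: "x \<in> cball 0 R"
      let ?z = "gu x" and ?z' = "gu (x + t *\<^sub>R v)"
      have "norm (F ?z' - F ?z - DF ?z (?z' - ?z)) \<le> \<epsilon> * norm (?z' - ?z)"
        using elim x v by (intro d(2) in_Z segment_in_cball) (auto simp: dist_norm)
      then have "norm ((1 / t) *\<^sub>R (F ?z' - F ?z - DF ?z (?z' - ?z))) \<le> \<epsilon> * norm ((1 / t) *\<^sub>R (?z' - ?z))"
        using elim by (simp add: divide_right_mono)
      then show "norm (P t v x - DF (gu x) (gD t v x)) \<le> \<epsilon> * norm (gD t v x)"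
        by (simp only: P_def gD_def DF_scale DF_diff scaleR_diff_right)
    qed
  qed
qed

lemma D_deriv: "(D t v has_derivative (\<lambda>h. gD t v x \<bullet> h)) (at x)"
proof -
  have "((\<lambda>x. u (x + t *\<^sub>R v)) has_derivative (\<lambda>h. gu (x + t *\<^sub>R v) \<bullet> h)) (at x)"
    by (rule has_derivative_compose[OF _ u_deriv]) (auto intro!: derivative_eq_intros)
  from has_derivative_mult_right[OF has_derivative_diff[OF this u_deriv], of "1 / t"]
  show ?thesis by (simp add: D_def[abs_def] gD_def inner_diff_left diff_divide_distrib)
qed

text \<open>Positivity at every t > 0, not merely in the limit, so that dividing by
  \<open>D t e\<close> yields admissible C1 test functions.\<close>

lemma D_e_pos: "0 < t \<Longrightarrow> 0 < D t e x"
  using directional_MVT[OF u_deriv, of t x e] monotone unfolding D_def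
  by (metis divide_pos_pos mult_pos_pos)

end

section \<open>Caccioppoli and Picone estimates\<close>

lemma eventually_at_right_pos: "\<forall>\<^sub>F t in at_right 0. 0 < (t::real)"
  by (simp add: eventually_at_right_less)

context monotone_solution
begin

lemma continuous_on_ell_gu: "continuous_on A (\<lambda>x. ell (gu x))"
  unfolding ell_def by (auto intro!: continuous_intros)

text \<open>Test the quotient equation with \<eta>^2 D. The constant may depend on the cut-off and
  the ball but not on t; it substitutes for a local L2 bound on second derivatives.\<close>

lemma caccioppoli:
  assumes v: "norm v \<le> 1"
    and \<eta>: "\<And>x. (\<eta> has_derivative (\<lambda>h. g\<eta> x \<bullet> h)) (at x)" "continuous_on UNIV g\<eta>"
      "\<And>x. norm x > R \<Longrightarrow> \<eta> x = 0" "\<And>x. \<bar>\<eta> x\<bar> \<le> 1"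
  shows "\<exists>C. \<forall>\<^sub>F t in at_right 0. (\<integral>x. rho x * ((\<eta> x)\<^sup>2 * (norm (gD t v x))\<^sup>2) \<partial>lborel) \<le> C"
proof -
  have g\<eta>0: "g\<eta> x = 0" if "norm x > R" for x using support_gradient_zero[OF \<eta>(1,3) that] .
  have c\<eta>: "continuous_on A \<eta>" for A by (rule has_derivative_continuous_on[OF has_derivative_at_withinI[OF \<eta>(1)]])
  obtain B0 where B0: "1 \<le> B0" "\<And>x. x \<in> cball 0 R \<Longrightarrow> norm (inverse (ell (gu x))) \<le> B0"
    by (rule bounded_on_cball[of "\<lambda>x. inverse (ell (gu x))" R])
       (use ell_pos[OF gu_nz] in \<open>auto intro!: continuous_on_inverse continuous_on_ell_gu simp: less_imp_neq[symmetric]\<close>)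
  \<comment> \<open>Lower bound of the ellipticity on the support ball; B0 >= 1 yields the \<nu> <=
    2 that the pointwise lemma asks for.\<close>
  define \<nu> where "\<nu> = 1 / B0"
  have \<nu>: "0 < \<nu>" "\<nu> \<le> 2" using B0(1) by (auto simp: \<nu>_def field_simps)
  have \<nu>_le: "\<nu> \<le> ell (gu x)" if "x \<in> cball 0 R" for x
    using B0(2)[OF that] B0(1) ell_pos[OF gu_nz, of x] by (simp add: \<nu>_def field_simps)
  obtain B1 where B1: "1 \<le> B1" "\<And>x. x \<in> cball 0 R \<Longrightarrow> norm (gu x) \<le> B1"
    using bounded_on_cball[OF continuous_on_gu] by blast
  obtain B2 where B2: "1 \<le> B2" "\<And>x. x \<in> cball 0 R \<Longrightarrow> norm (\<kappa> x) \<le> B2"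
    using bounded_on_cball[OF continuous_on_kappa] by blast
  obtain B3 where B3: "1 \<le> B3" "\<And>x. x \<in> cball 0 R \<Longrightarrow> norm (a (norm (gu x)) + \<bar>a' (norm (gu x))\<bar> * norm (gu x)) \<le> B3"
    by (rule bounded_on_cball[of "\<lambda>x. a (norm (gu x)) + \<bar>a' (norm (gu x))\<bar> * norm (gu x)" R])
       (auto intro!: continuous_intros)
  obtain B4 where B4: "1 \<le> B4" "\<And>x. x \<in> cball 0 R \<Longrightarrow> norm (g\<eta> x) \<le> B4"
    using bounded_on_cball[OF \<eta>(2)] by blast
  \<comment> \<open>One constant for all local bounds: quotient, zero-order term, operator norm of
    \<open>DF\<close>, cut-off gradient.\<close>
  define L where "L = (B1 + 1) + (B2 * (B1 + 1) + 1) + B3 + B4"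
  have L: "1 \<le> L" "B1 + 1 \<le> L" "B2 * (B1 + 1) + 1 \<le> L" "B3 \<le> L" "B4 \<le> L"
    using B1(1) B2(1) B3(1) B4(1) mult_nonneg_nonneg[of B2 "B1 + 1"] by (auto simp: L_def)
  define C where "C = 16 * L^6 / \<nu> + L^2"
  have C: "0 \<le> C" using L \<nu> by (simp add: C_def)
  have "\<forall>\<^sub>F t in at_right 0. (\<integral>x. rho x * ((\<eta> x)\<^sup>2 * (norm (gD t v x))\<^sup>2) \<partial>lborel) \<le> 4 / \<nu> * (C * (\<integral>x. rho x \<partial>(lborel :: (real^'n) measure)))"
    using eventually_at_right_pos D_limit[OF v zero_less_one, of R] S_limit[OF v zero_less_one, of R]
      P_limit[OF v, of "\<nu> / 2" R, simplified, OF \<nu>(1)]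
  proof eventually_elim
    case (elim t)
    let ?\<phi> = "\<lambda>x. (\<eta> x)\<^sup>2 * D t v x"
    let ?g = "\<lambda>x. (\<eta> x)\<^sup>2 *\<^sub>R gD t v x + (2 * \<eta> x * D t v x) *\<^sub>R g\<eta> x"
    have t: "t \<noteq> 0" using elim by simp
    have d: "(?\<phi> has_derivative (\<lambda>h. ?g x \<bullet> h)) (at x)" for x
      by (rule has_derivative_eq_rhs, rule has_derivative_mult[OF has_derivative_power[OF \<eta>(1)] D_deriv])
         (auto simp: inner_add_left algebra_simps)
    have c: "continuous_on UNIV ?g"
      by (intro continuous_intros c\<eta> \<eta>(2) t)
    have z: "?\<phi> x = 0" if "norm x > R" for x using \<eta>(3)[OF that] by simp
    note Q = quotient_equation[OF d c z t, of R v]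
    have i: "integrable lborel (\<lambda>x. rho x * ((\<eta> x)\<^sup>2 * (norm (gD t v x))\<^sup>2))"
      by (rule integrable_continuous_compact_support[where R=R])
         (auto intro!: continuous_intros c\<eta> t \<eta>(3) simp: \<eta>(3))
    have "(\<integral>x. \<nu> / 4 * (rho x * ((\<eta> x)\<^sup>2 * (norm (gD t v x))\<^sup>2)) - C * rho x \<partial>lborel)
        \<le> (\<integral>x. rho x * (P t v x \<bullet> ?g x + S t v x * ?\<phi> x) \<partial>lborel)"
    proof (intro integral_mono Q(2) Bochner_Integration.integrable_diff integrable_mult_right i gaussian_finite)
      fix x :: "real ^ 'n"
      show "\<nu> / 4 * (rho x * ((\<eta> x)\<^sup>2 * (norm (gD t v x))\<^sup>2)) - C * rho x \<le> rho x * (P t v x \<bullet> ?g x + S t v x * ?\<phi> x)"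
      proof (cases "x \<in> cball 0 R")
        case False
        then have "norm x > R" by simp
        then show ?thesis using \<eta>(3) g\<eta>0 C by simp
      next
        case x: True
        have w: "\<bar>gu x \<bullet> v\<bar> \<le> B1"
          using order_trans[OF Cauchy_Schwarz_ineq2 mult_mono[OF B1(2)[OF x] v]] B1(1) by simp
        have D: "\<bar>D t v x\<bar> \<le> B1 + 1" using elim(2) x w by fastforce
        have "\<bar>\<kappa> x * D t v x\<bar> \<le> B2 * (B1 + 1)"
          unfolding abs_mult using B2(2)[OF x] D B2(1) by (intro mult_mono) auto
        then have S: "\<bar>S t v x\<bar> \<le> B2 * (B1 + 1) + 1" using elim(3) x by fastforce
        have "norm (DF (gu x) (gD t v x)) \<le> L * norm (gD t v x)"
          using B3(2)[OF x] L by (intro order_trans[OF DF_norm[OF gu_nz]] mult_right_mono) auto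
        then have "\<nu> / 4 * ((\<eta> x)\<^sup>2 * (norm (gD t v x))\<^sup>2) - (16 * L^6 / \<nu> + L^2) \<le> P t v x \<bullet> ?g x + S t v x * ?\<phi> x"
          using x \<nu> \<nu>_le[OF x] L elim(4) \<eta>(4)[of x] D S B4(2)[OF x]
          by (intro caccioppoli_pointwise[OF gu_nz]) auto
        from mult_left_mono[OF this rho_nonneg[of x]] show ?thesis
          unfolding C_def[symmetric] by (simp add: algebra_simps)
      qed
    qed
    also have "\<dots> = 0" by (rule Q(1))
    also have "(\<integral>x. \<nu> / 4 * (rho x * ((\<eta> x)\<^sup>2 * (norm (gD t v x))\<^sup>2)) - C * rho x \<partial>lborel)
        = \<nu> / 4 * (\<integral>x. rho x * ((\<eta> x)\<^sup>2 * (norm (gD t v x))\<^sup>2) \<partial>lborel) - C * (\<integral>x. rho x \<partial>(lborel :: (real^'n) measure))"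
      by (simp only: Bochner_Integration.integral_diff integral_mult_right_zero integrable_mult_right i gaussian_finite)
    finally have "\<nu> / 4 * (\<integral>x. rho x * ((\<eta> x)\<^sup>2 * (norm (gD t v x))\<^sup>2) \<partial>lborel) \<le> C * (\<integral>x. rho x \<partial>(lborel :: (real^'n) measure))"
      by linarith
    then show ?case using \<nu> by (simp add: field_simps)
  qed
  then show ?thesis by blast
qed

text \<open>Both tested equations integrate to 0, so the lower bound of
  \<open>picone_pointwise\<close> has nonpositive integral; doubling turns its constants 1/2 and 2 M
  into 1 and 4 M.\<close>

lemma picone_limit:
  assumes v: "norm v \<le> 1" and \<epsilon>: "0 < \<epsilon>"
    and \<eta>: "\<And>x. (\<eta> has_derivative (\<lambda>h. g\<eta> x \<bullet> h)) (at x)" "continuous_on UNIV g\<eta>"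
      "\<And>x. norm x > R \<Longrightarrow> \<eta> x = 0" "\<And>x. \<bar>\<eta> x\<bar> \<le> 1"
  defines "Y \<equiv> \<lambda>t x. gD t v x - (D t v x / D t e x) *\<^sub>R gD t e x"
  shows "\<forall>\<^sub>F t in at_right 0. (\<integral>x. rho x * ((\<eta> x)\<^sup>2 * (DF (gu x) (Y t x) \<bullet> Y t x)) \<partial>lborel)
      \<le> 4 * M * (\<integral>x. rho x * (a (norm (gu x)) * (norm (gu x))\<^sup>2 * (norm (g\<eta> x))\<^sup>2) \<partial>lborel) + \<epsilon>"
proof -
  have e1: "norm e \<le> 1" using e_unit by simp
  have g\<eta>0: "g\<eta> x = 0" if "norm x > R" for x using support_gradient_zero[OF \<eta>(1,3) that] .
  have c\<eta>: "continuous_on A \<eta>" for A by (rule has_derivative_continuous_on[OF has_derivative_at_withinI[OF \<eta>(1)]])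
  obtain Cv where Cv: "\<forall>\<^sub>F t in at_right 0. (\<integral>x. rho x * ((\<eta> x)\<^sup>2 * (norm (gD t v x))\<^sup>2) \<partial>lborel) \<le> Cv"
    using caccioppoli[OF v \<eta>] by blast
  obtain Ce where Ce: "\<forall>\<^sub>F t in at_right 0. (\<integral>x. rho x * ((\<eta> x)\<^sup>2 * (norm (gD t e x))\<^sup>2) \<partial>lborel) \<le> Ce"
    using caccioppoli[OF e1 \<eta>] by blast
  define K where "K = (\<integral>x. rho x \<partial>(lborel :: (real^'n) measure))"
  obtain B0 where B0: "1 \<le> B0" "\<And>x. x \<in> cball 0 R \<Longrightarrow> norm (inverse (gu x \<bullet> e)) \<le> B0"
    by (rule bounded_on_cball[of "\<lambda>x. inverse (gu x \<bullet> e)" R])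
       (use monotone in \<open>auto intro!: continuous_intros continuous_on_gu simp: less_imp_neq[symmetric]\<close>)
  have h_ge: "1 / B0 \<le> gu x \<bullet> e" if "x \<in> cball 0 R" for x
    using B0(2)[OF that] B0(1) monotone[of x] by (simp add: field_simps)
  obtain B1 where B1: "1 \<le> B1" "\<And>x. x \<in> cball 0 R \<Longrightarrow> norm (gu x) \<le> B1"
    using bounded_on_cball[OF continuous_on_gu] by blast
  obtain B3 where B3: "1 \<le> B3" "\<And>x. x \<in> cball 0 R \<Longrightarrow> norm (M * a (norm (gu x))) \<le> B3"
    by (rule bounded_on_cball[of "\<lambda>x. M * a (norm (gu x))" R]) (auto intro!: continuous_intros)
  obtain B4 where B4: "1 \<le> B4" "\<And>x. x \<in> cball 0 R \<Longrightarrow> norm (g\<eta> x) \<le> B4"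
    using bounded_on_cball[OF \<eta>(2)] by blast
  define L where "L = (B1 + 1) + (B1 + 1) * (2 * B0) + B3 + B4"
  have L: "1 \<le> L" "B1 + 1 \<le> L" "(B1 + 1) * (2 * B0) \<le> L" "B3 \<le> L" "B4 \<le> L"
    using B0(1) B1(1) B3(1) B4(1) mult_nonneg_nonneg[of "B1 + 1" "2 * B0"] by (auto simp: L_def)
  \<comment> \<open>Total error mass: the Caccioppoli bounds for both directions plus the Gaussian
    mass. \<delta> makes the error \<epsilon>/2 before the final doubling.\<close>
  define Q where "Q = 10 * L^6 * (\<bar>Cv\<bar> + \<bar>Ce\<bar> + \<bar>K\<bar> + 1)"
  have Q: "0 < Q" using L by (auto simp: Q_def intro!: mult_pos_pos add_nonneg_pos)
  define \<delta> where "\<delta> = \<epsilon> / (2 * Q)"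
  have \<delta>: "0 < \<delta>" using \<epsilon> Q by (simp add: \<delta>_def)
  \<comment> \<open>W^2 - w^2 factors as (W - w)(W + w) with second factor at most 2 B1 + 1; the cap
    1 keeps |W| <= B1 + 1.\<close>
  define \<delta>w where "\<delta>w = min 1 (\<delta> / (2 * B1 + 1))"
  have \<delta>w: "0 < \<delta>w" "\<delta>w \<le> 1" using \<delta> B1(1) by (auto simp: \<delta>w_def)
  \<comment> \<open>Half of the lower bound 1/B0 of \<partial>_e u: within this distance
    \<open>D t e\<close> stays above 1/(2 B0), which bounds the ratio \<open>s\<close>.\<close>
  have B02: "0 < 1 / (2 * B0)" using B0(1) by simp
  show ?thesis
    using eventually_at_right_pos Cv Ce D_limit[OF v \<delta>w(1), of R] D_limit[OF e1 B02, of R]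
      S_limit[OF v \<delta>, of R] S_limit[OF e1 \<delta>, of R] P_limit[OF v \<delta>, of R] P_limit[OF e1 \<delta>, of R]
  proof eventually_elim
    case (elim t)
    have t: "t \<noteq> 0" using elim by simp
    have H: "0 < D t e x" for x using D_e_pos elim(1) .
    then have Hn: "D t e x \<noteq> 0" for x by (metis less_irrefl)
    define s where "s x = D t v x / D t e x" for x
    have sH: "D t v x = s x * D t e x" for x using Hn by (simp add: s_def)
    have cs: "continuous_on A s" for A
      unfolding s_def by (intro continuous_intros t ballI Hn)
    let ?\<phi>1 = "\<lambda>x. (\<eta> x)\<^sup>2 * D t v x"
    let ?g1 = "\<lambda>x. (\<eta> x)\<^sup>2 *\<^sub>R gD t v x + (2 * \<eta> x * D t v x) *\<^sub>R g\<eta> x"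
    have d1: "(?\<phi>1 has_derivative (\<lambda>h. ?g1 x \<bullet> h)) (at x)" for x
      by (rule has_derivative_eq_rhs, rule has_derivative_mult[OF has_derivative_power[OF \<eta>(1)] D_deriv])
         (auto simp: inner_add_left algebra_simps)
    have c1: "continuous_on UNIV ?g1"
      by (intro continuous_intros c\<eta> \<eta>(2) t)
    have z1: "?\<phi>1 x = 0" if "norm x > R" for x using \<eta>(3)[OF that] by simp
    have q1: "(\<integral>x. rho x * (P t v x \<bullet> ?g1 x + S t v x * ?\<phi>1 x) \<partial>lborel) = 0"
      and i1: "integrable lborel (\<lambda>x. rho x * (P t v x \<bullet> ?g1 x + S t v x * ?\<phi>1 x))"
      by (rule quotient_equation[OF d1 c1 z1 t]; assumption)+
    \<comment> \<open>This is \<eta>^2 W^2 / H, written with s = W/H to match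
      \<open>picone_pointwise\<close>.\<close>
    let ?\<phi>2 = "\<lambda>x. (\<eta> x)\<^sup>2 * s x * D t v x"
    let ?g2 = "\<lambda>x. (2 * \<eta> x * s x * D t v x) *\<^sub>R g\<eta> x + (2 * (\<eta> x)\<^sup>2 * s x) *\<^sub>R gD t v x - ((\<eta> x)\<^sup>2 * (s x)\<^sup>2) *\<^sub>R gD t e x"
    have ds: "(s has_derivative (\<lambda>h. (gD t v x \<bullet> h - s x * (gD t e x \<bullet> h)) / D t e x)) (at x)" for x
      unfolding s_def[abs_def]
      by (rule has_derivative_eq_rhs, rule has_derivative_divide'[OF D_deriv D_deriv Hn])
         (use Hn in \<open>auto simp: field_simps\<close>)
    have d2: "(?\<phi>2 has_derivative (\<lambda>h. ?g2 x \<bullet> h)) (at x)" for x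
      by (rule has_derivative_eq_rhs, rule has_derivative_mult[OF has_derivative_mult[OF has_derivative_power[OF \<eta>(1)] ds] D_deriv])
         (use Hn[of x] in \<open>auto simp: fun_eq_iff sH inner_add_left inner_diff_left field_simps power2_eq_square\<close>)
    have c2: "continuous_on UNIV ?g2"
      by (intro continuous_intros c\<eta> cs \<eta>(2) t)
    have z2: "?\<phi>2 x = 0" if "norm x > R" for x using \<eta>(3)[OF that] by simp
    have q2: "(\<integral>x. rho x * (P t e x \<bullet> ?g2 x + S t e x * ?\<phi>2 x) \<partial>lborel) = 0"
      and i2: "integrable lborel (\<lambda>x. rho x * (P t e x \<bullet> ?g2 x + S t e x * ?\<phi>2 x))"
      by (rule quotient_equation[OF d2 c2 z2 t]; assumption)+
    have cY: "continuous_on A (Y t)" for A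
      unfolding Y_def s_def[symmetric] by (intro continuous_intros t cs)
    let ?iY = "\<lambda>x. rho x * ((\<eta> x)\<^sup>2 * (DF (gu x) (Y t x) \<bullet> Y t x))"
    let ?iE = "\<lambda>x. rho x * (a (norm (gu x)) * (norm (gu x))\<^sup>2 * (norm (g\<eta> x))\<^sup>2)"
    let ?iv = "\<lambda>v x. rho x * ((\<eta> x)\<^sup>2 * (norm (gD t v x))\<^sup>2)"
    have iv: "integrable lborel (?iv v)" for v
      by (rule integrable_continuous_compact_support[where R=R])
         (auto intro!: continuous_intros c\<eta> t \<eta>(3) simp: \<eta>(3))
    have iY: "integrable lborel ?iY"
      by (rule integrable_continuous_compact_support[where R=R])
         (auto intro!: continuous_intros c\<eta> cY continuous_on_gu simp: \<eta>(3))
    have iE: "integrable lborel ?iE"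
      by (rule integrable_continuous_compact_support[where R=R])
         (auto intro!: continuous_intros continuous_on_gu \<eta>(2) simp: g\<eta>0)
    let ?low = "\<lambda>x. 1 / 2 * ?iY x - 2 * M * ?iE x - (\<delta> * (10 * L^6)) * (?iv v x + ?iv e x + rho x)"
    have "(\<integral>x. ?low x \<partial>lborel) \<le> (\<integral>x. rho x * (P t v x \<bullet> ?g1 x + S t v x * ?\<phi>1 x) - rho x * (P t e x \<bullet> ?g2 x + S t e x * ?\<phi>2 x) \<partial>lborel)"
    proof (intro integral_mono i1 i2 Bochner_Integration.integrable_diff Bochner_Integration.integrable_add
        integrable_mult_right iY iE iv gaussian_finite)
      fix x :: "real ^ 'n"
      show "?low x \<le> rho x * (P t v x \<bullet> ?g1 x + S t v x * ?\<phi>1 x) - rho x * (P t e x \<bullet> ?g2 x + S t e x * ?\<phi>2 x)"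
      proof (cases "x \<in> cball 0 R")
        case False
        then have "norm x > R" by simp
        then show ?thesis using \<eta>(3) g\<eta>0 \<delta> L by simp
      next
        case x: True
        let ?w = "gu x \<bullet> v"
        have w: "\<bar>?w\<bar> \<le> B1"
          using order_trans[OF Cauchy_Schwarz_ineq2 mult_mono[OF B1(2)[OF x] v]] B1(1) by simp
        have w2: "?w\<^sup>2 \<le> (norm (gu x))\<^sup>2"
          using order_trans[OF Cauchy_Schwarz_ineq2 mult_left_mono[OF v, of "norm (gu x)"]]
          by (simp add: abs_le_square_iff[symmetric])
        have Dw: "\<bar>D t v x - ?w\<bar> < \<delta>w" using elim(4) x by blast
        then have D: "\<bar>D t v x\<bar> \<le> B1 + 1" using w \<delta>w by linarith
        have "(D t v x)\<^sup>2 - ?w\<^sup>2 = (D t v x - ?w) * (D t v x + ?w)" by (simp add: power2_eq_square algebra_simps)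
        also have "\<bar>\<dots>\<bar> \<le> (\<delta> / (2 * B1 + 1)) * (2 * B1 + 1)"
          unfolding abs_mult using Dw D w \<delta> B1(1) by (intro mult_mono) (auto simp: \<delta>w_def)
        also have "\<dots> = \<delta>" using B1(1) by simp
        finally have Ww: "\<bar>(D t v x)\<^sup>2 - ?w\<^sup>2\<bar> \<le> \<delta>" .
        have "\<bar>D t e x - gu x \<bullet> e\<bar> < 1 / (2 * B0)" using elim(5) x by blast
        moreover have "1 / B0 = 2 * (1 / (2 * B0))" by simp
        ultimately have "1 / (2 * B0) \<le> D t e x" using h_ge[OF x] by linarith
        then have "inverse (D t e x) \<le> 2 * B0" using H[of x] B0(1) by (simp add: field_simps)
        then have "\<bar>s x\<bar> \<le> (B1 + 1) * (2 * B0)"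
          unfolding s_def divide_inverse abs_mult using D H[of x] B1(1) by (intro mult_mono) auto
        then have s: "\<bar>s x\<bar> \<le> L" using L by linarith
        have "(\<eta> x)\<^sup>2 * (DF (gu x) (Y t x) \<bullet> Y t x) / 2 - 2 * M * a (norm (gu x)) * ?w\<^sup>2 * (norm (g\<eta> x))\<^sup>2
            - \<delta> * (10 * L^6) * ((\<eta> x)\<^sup>2 * (norm (gD t v x))\<^sup>2 + (\<eta> x)\<^sup>2 * (norm (gD t e x))\<^sup>2 + 1)
          \<le> P t v x \<bullet> ?g1 x + S t v x * ?\<phi>1 x - (P t e x \<bullet> ?g2 x + S t e x * ?\<phi>2 x)"
          unfolding Y_def s_def[symmetric]
        proof (rule picone_pointwise[where \<kappa> = "\<kappa> x" and H = "D t e x"])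
          show "M * a (norm (gu x)) \<le> L" using B3(2)[OF x] L by simp
          show "\<bar>S t v x - \<kappa> x * D t v x\<bar> \<le> \<delta>" "\<bar>S t e x - \<kappa> x * D t e x\<bar> \<le> \<delta>"
            using elim(6,7) x less_imp_le by blast+
          show "norm (P t v x - DF (gu x) (gD t v x)) \<le> \<delta> * norm (gD t v x)"
            "norm (P t e x - DF (gu x) (gD t e x)) \<le> \<delta> * norm (gD t e x)"
            using elim(8,9) x by blast+
          show "norm (g\<eta> x) \<le> L" using B4(2)[OF x] L by linarith
          show "\<bar>D t v x\<bar> \<le> L" using D L by linarith
        qed (use L \<delta> s \<eta>(4) Ww sH in auto)
        moreover have "2 * M * a (norm (gu x)) * ?w\<^sup>2 * (norm (g\<eta> x))\<^sup>2
            \<le> 2 * M * a (norm (gu x)) * (norm (gu x))\<^sup>2 * (norm (g\<eta> x))\<^sup>2"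
          using M_ge1 a_pos[of "norm (gu x)"] by (intro mult_right_mono mult_left_mono w2) auto
        ultimately have "(\<eta> x)\<^sup>2 * (DF (gu x) (Y t x) \<bullet> Y t x) / 2 - 2 * M * a (norm (gu x)) * (norm (gu x))\<^sup>2 * (norm (g\<eta> x))\<^sup>2
            - \<delta> * (10 * L^6) * ((\<eta> x)\<^sup>2 * (norm (gD t v x))\<^sup>2 + (\<eta> x)\<^sup>2 * (norm (gD t e x))\<^sup>2 + 1)
          \<le> P t v x \<bullet> ?g1 x + S t v x * ?\<phi>1 x - (P t e x \<bullet> ?g2 x + S t e x * ?\<phi>2 x)"
          by linarith
        from mult_left_mono[OF this rho_nonneg[of x]] show ?thesis
          by (simp only: right_diff_distrib) (simp add: algebra_simps)
      qed
    qed
    also have "\<dots> = 0"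
      by (simp only: Bochner_Integration.integral_diff[OF i1 i2] q1 q2 diff_self)
    also have "(\<integral>x. ?low x \<partial>lborel) = 1 / 2 * (\<integral>x. ?iY x \<partial>lborel) - 2 * M * (\<integral>x. ?iE x \<partial>lborel)
       - (\<delta> * (10 * L^6)) * ((\<integral>x. ?iv v x \<partial>lborel) + (\<integral>x. ?iv e x \<partial>lborel) + K)"
      unfolding K_def
      by (simp only: Bochner_Integration.integral_diff Bochner_Integration.integral_add integral_mult_right_zero
          Bochner_Integration.integrable_diff Bochner_Integration.integrable_add
          integrable_mult_right iY iE iv gaussian_finite)
    finally have "1 / 2 * (\<integral>x. ?iY x \<partial>lborel) - 2 * M * (\<integral>x. ?iE x \<partial>lborel)
       \<le> (\<delta> * (10 * L^6)) * ((\<integral>x. ?iv v x \<partial>lborel) + (\<integral>x. ?iv e x \<partial>lborel) + K)" by linarith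
    also have "\<dots> \<le> (\<delta> * (10 * L^6)) * (\<bar>Cv\<bar> + \<bar>Ce\<bar> + \<bar>K\<bar> + 1)"
      using elim(2,3) \<delta> L by (intro mult_left_mono) auto
    also have "\<dots> = \<epsilon> / 2"
      using Q unfolding \<delta>_def Q_def by (simp add: field_simps)
    finally show ?case by (simp add: field_simps)
  qed
qed

end

section \<open>Logarithmic cut-offs\<close>

text \<open>The squared positive part is C1 and vanishes on a half-line; it is the building block of
  the cut-offs.\<close>

definition sq_pos :: "real \<Rightarrow> real" where
  "sq_pos x = (max 0 x)\<^sup>2"

lemma sq_pos_deriv: "(sq_pos has_real_derivative 2 * max 0 x) (at x)"
proof -
  consider "x > 0" | "x < 0" | "x = 0" by linarith
  then show ?thesis
  proof cases
    case 1
    have "((\<lambda>x. x\<^sup>2) has_real_derivative 2 * max 0 x) (at x)"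
      using 1 by (auto intro!: derivative_eq_intros)
    then show ?thesis
      by (rule has_field_derivative_transform_within_open[where S="{0<..}"]) (use 1 in \<open>auto simp: sq_pos_def\<close>)
  next
    case 2
    have "((\<lambda>x. 0) has_real_derivative 2 * max 0 x) (at x)"
      using 2 by auto
    then show ?thesis
      by (rule has_field_derivative_transform_within_open[where S="{..<0}"]) (use 2 in \<open>auto simp: sq_pos_def\<close>)
  next
    case 3
    \<comment> \<open>Caratheodory's criterion at the gluing point: the difference quotient at 0 is
      \<open>max 0 z\<close>, which is continuous.\<close>
    have "\<forall>z. sq_pos z - sq_pos 0 = max 0 z * (z - 0)" by (auto simp: sq_pos_def power2_eq_square max_def)
    moreover have "isCont (\<lambda>z::real. max 0 z) 0" by (intro continuous_intros)
    ultimately show ?thesis unfolding 3 CARAT_DERIV by (intro exI[of _ "\<lambda>z. max 0 z"]) auto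
  qed
qed

text \<open>A piecewise polynomial C1 cut-off, 1 for s <= 1 and 0 for s >= 2. The inner squared
  positive part smooths the corner at 1, the outer one the corner at 2.\<close>

definition ramp :: "real \<Rightarrow> real" where
  "ramp s = sq_pos (1 - sq_pos (s - 1))"

definition ramp' :: "real \<Rightarrow> real" where
  "ramp' s = 2 * max 0 (1 - sq_pos (s - 1)) * - (2 * max 0 (s - 1))"

lemma ramp_deriv: "(ramp has_real_derivative ramp' s) (at s)"
proof -
  have "((\<lambda>s. sq_pos (s - 1)) has_real_derivative 2 * max 0 (s - 1) * 1) (at s)"
    by (rule DERIV_chain2[OF sq_pos_deriv]) (auto intro!: derivative_eq_intros)
  then have "((\<lambda>s. 1 - sq_pos (s - 1)) has_real_derivative - (2 * max 0 (s - 1))) (at s)"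
    by (auto intro!: derivative_eq_intros)
  from DERIV_chain2[OF sq_pos_deriv this] show ?thesis by (simp add: ramp_def[abs_def] ramp'_def)
qed

lemma continuous_on_ramp' [continuous_intros]: "continuous_on A g \<Longrightarrow> continuous_on A (\<lambda>x. ramp' (g x))"
  unfolding ramp'_def sq_pos_def by (intro continuous_intros)

lemma ramp_bounds: "0 \<le> ramp s" "ramp s \<le> 1"
  by (auto simp: ramp_def sq_pos_def power_le_one_iff)

lemma ramp_eq_1: "s \<le> 1 \<Longrightarrow> ramp s = 1"
  by (simp add: ramp_def sq_pos_def)

lemma sq_pos_ge1: "2 \<le> s \<Longrightarrow> 1 \<le> sq_pos (s - 1)"
  by (simp add: sq_pos_def)

lemma ramp_eq_0: "2 \<le> s \<Longrightarrow> ramp s = 0"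
  using sq_pos_ge1[of s] by (simp add: ramp_def sq_pos_def[of "1 - _"])

lemma ramp'_eq_0: "s \<le> 1 \<or> 2 \<le> s \<Longrightarrow> ramp' s = 0"
  using sq_pos_ge1[of s] by (auto simp: ramp'_def)

lemma ramp'_bound: "\<bar>ramp' s\<bar> \<le> 4"
proof (cases "1 \<le> s \<and> s \<le> 2")
  case True
  have "\<bar>ramp' s\<bar> = (2 * max 0 (1 - sq_pos (s - 1))) * (2 * max 0 (s - 1))" by (simp add: ramp'_def abs_mult)
  also have "\<dots> \<le> (2 * 1) * (2 * 1)"
    using True by (intro mult_mono) (auto simp: sq_pos_def)
  finally show ?thesis by simp
next
  case False then show ?thesis using ramp'_eq_0[of s] by auto
qed

text \<open>Using |x|^2 keeps the cut-off differentiable at the origin. The transition happens for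
  4^k < |x|^2 < 2 * 4^k, and these annuli are disjoint for different k.\<close>

definition bump :: "nat \<Rightarrow> 'a::euclidean_space \<Rightarrow> real" where
  "bump k x = ramp ((norm x)\<^sup>2 / 4 ^ k)"

definition bump_grad :: "nat \<Rightarrow> 'a::euclidean_space \<Rightarrow> 'a" where
  "bump_grad k x = (ramp' ((norm x)\<^sup>2 / 4 ^ k) * (2 / 4 ^ k)) *\<^sub>R x"

lemma bump_deriv: "(bump k has_derivative (\<lambda>h. bump_grad k x \<bullet> h)) (at x)"
proof -
  have "((\<lambda>x. (x \<bullet> x) / 4 ^ k) has_derivative (\<lambda>h. (x \<bullet> h + h \<bullet> x) / 4 ^ k)) (at x)"
    by (auto intro!: derivative_eq_intros simp: divide_inverse)
  from has_derivative_compose[OF this ramp_deriv[THEN has_field_derivative_imp_has_derivative]]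
  show ?thesis
    by (simp add: bump_def[abs_def] bump_grad_def power2_norm_eq_inner inner_commute field_simps)
qed

lemma continuous_on_bump_grad [continuous_intros]: "continuous_on A (bump_grad k)"
  unfolding bump_grad_def by (intro continuous_intros) auto

lemma bump_bounds: "0 \<le> bump k x" "bump k x \<le> 1"
  using ramp_bounds by (auto simp: bump_def)

lemma four_power: "(4::real) ^ k = (2 ^ k)\<^sup>2"
  by (simp add: power2_eq_square power_mult_distrib[symmetric])

lemma bump_eq_1: "norm x \<le> 2 ^ k \<Longrightarrow> bump k x = 1"
  by (auto simp: bump_def four_power divide_le_eq intro!: ramp_eq_1 power_mono)

lemma bump_eq_0:
  assumes "2 ^ Suc k \<le> norm x" shows "bump k x = 0"
proof -
  have "(2 ^ Suc k)\<^sup>2 \<le> (norm x)\<^sup>2" using assms by (intro power_mono) auto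
  then have "4 * 4 ^ k \<le> (norm x)\<^sup>2" by (simp add: four_power power_mult_distrib)
  moreover have "0 < (4::real) ^ k" by simp
  ultimately have "2 * 4 ^ k \<le> (norm x)\<^sup>2" by linarith
  then have "2 \<le> (norm x)\<^sup>2 / 4 ^ k" by (simp add: field_simps)
  then show ?thesis by (simp add: bump_def ramp_eq_0)
qed

lemma bump_grad_support:
  assumes "bump_grad k x \<noteq> 0" shows "4 ^ k < (norm x)\<^sup>2" "(norm x)\<^sup>2 < 2 * 4 ^ k"
proof -
  have "ramp' ((norm x)\<^sup>2 / 4 ^ k) \<noteq> 0" using assms by (auto simp: bump_grad_def)
  then have "1 < (norm x)\<^sup>2 / 4 ^ k \<and> (norm x)\<^sup>2 / 4 ^ k < 2"
    using ramp'_eq_0 not_le by blast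
  then show "4 ^ k < (norm x)\<^sup>2" "(norm x)\<^sup>2 < 2 * 4 ^ k" by (auto simp: field_simps)
qed

text \<open>
  The supports of these gradients are disjoint, so averaging \<open>N\<close> dyadic cut-offs gains a factor \<open>1 / N\<close>.
\<close>

lemma bump_grad_orthogonal:
  assumes "k \<noteq> l" shows "bump_grad k x \<bullet> bump_grad l x = 0"
proof (rule ccontr)
  assume "\<not> ?thesis"
  then have nz: "bump_grad k x \<noteq> 0" "bump_grad l x \<noteq> 0" by auto
  have False if "k < l" "bump_grad k x \<noteq> 0" "bump_grad l x \<noteq> 0" for k l
  proof -
    have "(4::real) * 4 ^ k \<le> 4 ^ l" using that(1) power_increasing[of "Suc k" l "4::real"] by simp
    then show False using bump_grad_support(2)[OF that(2)] bump_grad_support(1)[OF that(3)]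
      by (smt (verit) zero_less_power)
  qed
  with nz assms show False by (metis nat_neq_iff)
qed

text \<open>128 = 4^2 * 2^2 * 2, from |ramp'| <= 4, the factor 2/4^k, and |x|^2 < 2 * 4^k on the
  support.\<close>

lemma bump_grad_bound: "(norm (bump_grad k x))\<^sup>2 \<le> 128 / 4 ^ k * indicator (ball 0 (2 ^ Suc k)) x"
proof (cases "bump_grad k x = 0")
  case False
  note s = bump_grad_support[OF False]
  have "(norm x)\<^sup>2 < 4 * 4 ^ k" using s(2) zero_less_power[of "4::real" k] by linarith
  then have "(norm x)\<^sup>2 < (2 ^ Suc k)\<^sup>2" by (simp add: four_power power_mult_distrib)
  then have x: "norm x < 2 ^ Suc k" by (rule power_less_imp_less_base) simp
  have "(norm (bump_grad k x))\<^sup>2 = (ramp' ((norm x)\<^sup>2 / 4 ^ k))\<^sup>2 * (2 / 4 ^ k)\<^sup>2 * (norm x)\<^sup>2"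
    by (simp add: bump_grad_def power_mult_distrib power_divide)
  also have "\<dots> \<le> 4\<^sup>2 * (2 / 4 ^ k)\<^sup>2 * (2 * 4 ^ k)"
    using s(2) ramp'_bound[of "(norm x)\<^sup>2 / 4 ^ k"]
    by (intro mult_mono) (auto simp: abs_le_square_iff[of _ 4, simplified, symmetric])
  also have "\<dots> = 128 / 4 ^ k" by (simp add: power2_eq_square)
  finally show ?thesis using x by simp
qed simp

text \<open>A staircase version of the logarithmic cut-off: the value falls by 1/N on each dyadic
  scale between 2^m and 2^(m+N).\<close>

definition log_cut :: "nat \<Rightarrow> nat \<Rightarrow> 'a::euclidean_space \<Rightarrow> real" where
  "log_cut m N x = 1 / real N * (\<Sum>k=m..<m+N. bump k x)"

definition log_cut_grad :: "nat \<Rightarrow> nat \<Rightarrow> 'a::euclidean_space \<Rightarrow> 'a" where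
  "log_cut_grad m N x = (1 / real N) *\<^sub>R (\<Sum>k=m..<m+N. bump_grad k x)"

lemma log_cut_deriv: "(log_cut m N has_derivative (\<lambda>h. log_cut_grad m N x \<bullet> h)) (at x)"
  using has_derivative_mult_right[OF has_derivative_sum[of "{m..<m+N}" bump "\<lambda>k h. bump_grad k x \<bullet> h"], OF bump_deriv, of "1 / real N"]
  by (simp add: log_cut_def[abs_def] log_cut_grad_def inner_sum_left)

lemma continuous_on_log_cut_grad: "continuous_on A (log_cut_grad m N)"
  unfolding log_cut_grad_def by (intro continuous_intros)

lemma log_cut_bounds:
  assumes "0 < N" shows "\<bar>log_cut m N x\<bar> \<le> 1"
proof -
  have "(\<Sum>k=m..<m+N. bump k x) \<le> real (card {m..<m+N}) * 1"
    by (intro sum_bounded_above bump_bounds)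
  moreover have "0 \<le> (\<Sum>k=m..<m+N. bump k x)" by (intro sum_nonneg bump_bounds)
  ultimately show ?thesis using assms by (simp add: log_cut_def)
qed

lemma log_cut_eq_1:
  assumes "0 < N" "norm x \<le> 2 ^ m" shows "log_cut m N x = 1"
proof -
  have "bump k x = 1" if "m \<le> k" for k
    using order_trans[OF assms(2) power_increasing[OF that]] by (intro bump_eq_1) simp
  then show ?thesis using assms(1) by (simp add: log_cut_def)
qed

lemma log_cut_eq_0:
  assumes "2 ^ (m + N) < norm x" shows "log_cut m N x = 0"
proof -
  have "bump k x = 0" if "k < m + N" for k
    using assms power_increasing[of "Suc k" "m + N" "2::real"] that by (intro bump_eq_0) simp
  then show ?thesis by (simp add: log_cut_def)
qed

text \<open>Pythagoras for pairwise orthogonal gradients: the prefactor 1/N^2 meets a plain sum of N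
  squares, with no cross terms.\<close>

lemma log_cut_grad_bound:
  "(norm (log_cut_grad m N x))\<^sup>2 \<le> 1 / (real N)\<^sup>2 * (\<Sum>k=m..<m+N. 128 / 4 ^ k * indicator (ball 0 (2 ^ Suc k)) x)"
proof -
  have "(norm (\<Sum>k=m..<m+N. bump_grad k x))\<^sup>2 = (\<Sum>k=m..<m+N. (norm (bump_grad k x))\<^sup>2)"
    by (rule norm_sum_Pythagorean) (auto simp: pairwise_def orthogonal_def bump_grad_orthogonal)
  also have "\<dots> \<le> (\<Sum>k=m..<m+N. 128 / 4 ^ k * indicator (ball 0 (2 ^ Suc k)) x)"
    by (intro sum_mono bump_grad_bound)
  finally show ?thesis
    by (simp add: log_cut_grad_def power_mult_distrib power_divide divide_right_mono)
qed

text \<open>Only the limit of the gradient energies is known, so \<open>\<sigma> (x + y) - \<sigma> x\<close> is averaged over a small box of points \<open>x\<close>.\<close>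

lemma limit_constant:
  fixes s :: "real \<Rightarrow> 'a::euclidean_space \<Rightarrow> real"
  assumes d: "\<And>t x. 0 < t \<Longrightarrow> (s t has_derivative (\<lambda>h. gs t x \<bullet> h)) (at x)"
    and c: "\<And>t. 0 < t \<Longrightarrow> continuous_on UNIV (gs t)"
    and energy: "\<And>r \<epsilon>. 0 < \<epsilon> \<Longrightarrow> \<forall>\<^sub>F t in at_right 0. (\<integral>x. indicator (cball 0 r) x * (norm (gs t x))\<^sup>2 \<partial>lborel) \<le> \<epsilon>"
    and lim: "\<And>r \<epsilon>. 0 < \<epsilon> \<Longrightarrow> \<forall>\<^sub>F t in at_right 0. \<forall>x\<in>cball 0 r. \<bar>s t x - \<sigma> x\<bar> < \<epsilon>"
    and cont: "continuous_on UNIV \<sigma>"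
  shows "\<sigma> x0 \<ge> \<sigma> y0"
proof (rule ccontr)
  assume neg: "\<not> ?thesis"
  define \<Delta> where "\<Delta> = \<sigma> y0 - \<sigma> x0"
  define y where "y = y0 - x0"
  have \<Delta>: "\<Delta> > 0" using neg by (simp add: \<Delta>_def)
  have y: "y \<noteq> 0" using \<Delta> by (auto simp: y_def \<Delta>_def)
  \<comment> \<open>By continuity the increment stays above \<Delta>/2 near \<open>x0\<close>, which
    makes room for a box of positive volume.\<close>
  define U where "U = {x. \<Delta> / 2 < \<sigma> (x + y) - \<sigma> x}"
  have "open U"
    unfolding U_def
    by (intro open_Collect_less continuous_intros continuous_on_compose2[OF cont]) auto
  moreover have "x0 \<in> U" using \<Delta> by (simp add: U_def y_def \<Delta>_def)
  ultimately obtain p q where B: "cbox p q \<subseteq> U" "x0 \<in> box p q"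
    using open_contains_cbox[of U x0] by metis
  define V where "V = measure lborel (cbox p q)"
  have V: "V > 0"
    unfolding V_def content_pos_lt_eq using B(2) by (fastforce simp: mem_box)
  obtain b where b: "\<And>x. x \<in> cbox p q \<Longrightarrow> norm x \<le> b"
    using bounded_cbox[of p q] by (auto simp: bounded_iff)
  \<comment> \<open>This ball contains every translate of the box along the segment from 0 to
    \<open>y\<close>.\<close>
  define r where "r = b + norm y"
  have in_r: "x + z *\<^sub>R y \<in> cball 0 r" if "x \<in> cbox p q" "z \<in> {0..1}" for x z
  proof -
    have "norm (z *\<^sub>R y) \<le> 1 * norm y" unfolding norm_scaleR using that by (intro mult_right_mono) auto
    then show ?thesis using b[OF that(1)] norm_triangle_ineq[of x "z *\<^sub>R y"] by (simp add: r_def)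
  qed
  \<comment> \<open>Young's inequality |g| <= \<tau> + |g|^2/\<tau> and energy at most \<tau>^2 V
    bound the integrated increment by 2 |y| \<tau> V = \<Delta> V/8, below the lower bound \<Delta>
    V/4.\<close>
  define \<tau> where "\<tau> = \<Delta> / (16 * norm y)"
  have \<tau>: "\<tau> > 0" using \<Delta> y by (simp add: \<tau>_def)
  define \<epsilon> where "\<epsilon> = \<tau> * \<tau> * V"
  have \<epsilon>: "\<epsilon> > 0" using \<tau> V by (simp add: \<epsilon>_def)
  \<comment> \<open>Two approximation errors of this size reduce the increment \<Delta>/2 to
    \<Delta>/4.\<close>
  have \<Delta>8: "0 < \<Delta> / 8" using \<Delta> by simp
  have "\<forall>\<^sub>F t in at_right (0::real). False"
    using eventually_at_right_pos energy[OF \<epsilon>, of r] lim[OF \<Delta>8, of r]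
  proof eventually_elim
    case (elim t)
    note dt = d[OF elim(1)] and ct = c[OF elim(1)]
    have cs: "continuous_on A (s t)" for A
      by (rule has_derivative_continuous_on[OF has_derivative_at_withinI[OF dt]])
    \<comment> \<open>Integrating over the box before using the mean value theorem in
      \<open>z\<close> yields one translate that serves the whole box at once.\<close>
    define m where "m z = integral (cbox p q) (\<lambda>x. s t (x + z *\<^sub>R y))" for z
    define m' where "m' z = integral (cbox p q) (\<lambda>x. gs t (x + z *\<^sub>R y) \<bullet> y)" for z
    have "(m has_vector_derivative m' z) (at z within UNIV)" for z
      unfolding m_def m'_def
    proof (rule leibniz_rule_vector_derivative)
      show "((\<lambda>z. s t (x + z *\<^sub>R y)) has_vector_derivative gs t (x + z *\<^sub>R y) \<bullet> y) (at z within UNIV)" for x z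
        unfolding has_vector_derivative_def
        by (rule has_derivative_eq_rhs, rule has_derivative_compose[OF _ dt])
           (auto intro!: derivative_eq_intros)
      show "(\<lambda>x. s t (x + z *\<^sub>R y)) integrable_on cbox p q" for z
        by (intro integrable_continuous continuous_on_compose2[OF cs[of UNIV]] continuous_intros) auto
      show "continuous_on (UNIV \<times> cbox p q) (\<lambda>(z, x). gs t (x + z *\<^sub>R y) \<bullet> y)"
        unfolding split_beta
        by (intro continuous_intros continuous_on_compose2[OF ct]) auto
    qed auto
    then have "(m has_real_derivative m' z) (at z)" for z
      by (simp add: has_real_derivative_iff_has_vector_derivative)
    then obtain z where z: "0 < z" "z < 1" "m 1 - m 0 = (1 - 0) * m' z"
      using MVT2[of 0 1 m m'] by auto
    have "\<Delta> / 4 * V = integral (cbox p q) (\<lambda>x. \<Delta> / 4)" by (simp add: V_def)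
    also have "\<dots> \<le> integral (cbox p q) (\<lambda>x. s t (x + 1 *\<^sub>R y) - s t (x + 0 *\<^sub>R y))"
    proof (rule integral_le)
      show "(\<lambda>x. s t (x + 1 *\<^sub>R y) - s t (x + 0 *\<^sub>R y)) integrable_on cbox p q"
        by (intro integrable_continuous continuous_on_compose2[OF cs[of UNIV]] continuous_intros) auto
      fix x assume x: "x \<in> cbox p q"
      have "\<Delta> / 2 < \<sigma> (x + y) - \<sigma> x" using B(1) x by (auto simp: U_def)
      moreover have "\<bar>s t (x + y) - \<sigma> (x + y)\<bar> < \<Delta> / 8" "\<bar>s t x - \<sigma> x\<bar> < \<Delta> / 8"
        using elim(3) in_r[OF x, of 1] in_r[OF x, of 0] by auto
      ultimately show "\<Delta> / 4 \<le> s t (x + 1 *\<^sub>R y) - s t (x + 0 *\<^sub>R y)"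
        unfolding abs_less_iff scaleR_one scaleR_zero_left add_0_right by linarith
    qed auto
    also have "\<dots> = m 1 - m 0"
      unfolding m_def
      by (intro Henstock_Kurzweil_Integration.integral_diff integrable_continuous continuous_on_compose2[OF cs[of UNIV]] continuous_intros) auto
    also have "\<dots> = m' z" using z by simp
    also have "\<dots> \<le> integral (cbox p q) (\<lambda>x. norm y * (\<tau> + (norm (gs t (x + z *\<^sub>R y)))\<^sup>2 / \<tau>))"
      unfolding m'_def
    proof (rule integral_le)
      fix x
      let ?g = "gs t (x + z *\<^sub>R y)"
      have "norm ?g \<le> \<tau> + (norm ?g)\<^sup>2 / \<tau>"
      proof -
        have "2 * norm ?g * \<tau> \<le> (norm ?g)\<^sup>2 + \<tau>\<^sup>2" by (rule sum_squares_bound)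
        moreover have "0 \<le> norm ?g * \<tau>" using \<tau> by simp
        ultimately have "norm ?g * \<tau> \<le> (norm ?g)\<^sup>2 + \<tau>\<^sup>2" by linarith
        then have "norm ?g \<le> ((norm ?g)\<^sup>2 + \<tau>\<^sup>2) / \<tau>" using \<tau> by (simp add: pos_le_divide_eq)
        then show ?thesis using \<tau> by (simp add: add_divide_distrib power2_eq_square[of \<tau>])
      qed
      then have "norm y * norm ?g \<le> norm y * (\<tau> + (norm ?g)\<^sup>2 / \<tau>)" by (intro mult_left_mono) auto
      then show "?g \<bullet> y \<le> norm y * (\<tau> + (norm ?g)\<^sup>2 / \<tau>)"
        using norm_cauchy_schwarz[of ?g y] by (simp add: mult.commute)
    qed (use \<tau> in \<open>auto intro!: integrable_continuous continuous_intros continuous_on_compose2[OF ct]\<close>)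
    also have "\<dots> = (\<integral>x. norm y * (\<tau> * indicator (cbox p q) x + 1 / \<tau> * (indicator (cbox p q) x * (norm (gs t (x + z *\<^sub>R y)))\<^sup>2)) \<partial>lborel)"
    proof -
      let ?f = "\<lambda>x. norm y * (\<tau> + (norm (gs t (x + z *\<^sub>R y)))\<^sup>2 / \<tau>)"
      have "set_integrable lborel (cbox p q) ?f"
        unfolding set_integrable_def using \<tau>
        by (intro borel_integrable_compact continuous_intros continuous_on_compose2[OF ct]) auto
      from set_borel_integral_eq_integral(2)[OF this] show ?thesis
        unfolding set_lebesgue_integral_def
        by (simp add: algebra_simps)
    qed
    also have "\<dots> \<le> norm y * (\<tau> * V + 1 / \<tau> * \<epsilon>)"
    proof -
      let ?g = "\<lambda>x. (norm (gs t x))\<^sup>2"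
      have i1: "integrable lborel (\<lambda>x. indicator (cbox p q) x * ?g (x + z *\<^sub>R y))"
        by (intro integrable_indicator_compact continuous_intros continuous_on_compose2[OF ct]) auto
      have i2: "integrable lborel (\<lambda>x. indicator (cball (- z *\<^sub>R y) r) x * ?g (x + z *\<^sub>R y))"
        by (intro integrable_indicator_compact continuous_intros continuous_on_compose2[OF ct]) auto
      have shift: "indicator (cball (- z *\<^sub>R y) r) x = (indicator (cball 0 r) (x + z *\<^sub>R y) :: real)" for x
        by (simp add: indicator_def dist_commute[of _ x]) (simp add: dist_norm)
      have i3: "integrable lborel (\<lambda>x. indicator (cball 0 r) x * ?g x)"
        by (intro integrable_indicator_compact continuous_intros ct) auto
      have i0: "integrable lborel (indicator (cbox p q) :: 'a \<Rightarrow> real)"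
        using integrable_indicator_compact[of "cbox p q" "\<lambda>_. 1"] by simp
      have "(\<integral>x. indicator (cbox p q) x * ?g (x + z *\<^sub>R y) \<partial>lborel)
          \<le> (\<integral>x. indicator (cball 0 r) (x + z *\<^sub>R y) * ?g (x + z *\<^sub>R y) \<partial>lborel)"
        using in_r z i2 unfolding shift by (intro integral_mono i1) (auto simp: indicator_def)
      also have "\<dots> = (\<integral>x. indicator (cball 0 r) x * ?g x \<partial>lborel)"
        using borel_measurable_integrable[OF i3] by (intro integral_lborel_shift[where g="\<lambda>x. indicator (cball 0 r) x * ?g x"]) simp
      also have "\<dots> \<le> \<epsilon>" by (rule elim(2))
      finally have le: "(\<integral>x. indicator (cbox p q) x * ?g (x + z *\<^sub>R y) \<partial>lborel) \<le> \<epsilon>" .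
      have "(\<integral>x. norm y * (\<tau> * indicator (cbox p q) x + 1 / \<tau> * (indicator (cbox p q) x * ?g (x + z *\<^sub>R y))) \<partial>lborel)
        = norm y * (\<tau> * (\<integral>x. indicator (cbox p q) x \<partial>lborel) + 1 / \<tau> * (\<integral>x. indicator (cbox p q) x * ?g (x + z *\<^sub>R y) \<partial>lborel))"
        by (simp only: integral_mult_right_zero Bochner_Integration.integral_add integrable_mult_right i1 i0)
      also have "\<dots> = norm y * (\<tau> * V + 1 / \<tau> * (\<integral>x. indicator (cbox p q) x * ?g (x + z *\<^sub>R y) \<partial>lborel))"
        by (simp add: V_def)
      also have "\<dots> \<le> norm y * (\<tau> * V + 1 / \<tau> * \<epsilon>)"
        using le \<tau> by (intro mult_left_mono add_left_mono) auto
      finally show ?thesis .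
    qed
    also have "\<dots> = \<Delta> / 8 * V"
      using \<tau> y by (simp add: \<epsilon>_def \<tau>_def field_simps)
    finally show False using \<Delta> V by simp
  qed
  then show False by (simp add: trivial_limit_at_right_real)
qed

section \<open>One-dimensional symmetry under quadratic energy growth\<close>

context monotone_solution
begin

lemma continuous_on_energy: "continuous_on A (\<lambda>x. a (norm (gu x)) * (norm (gu x))\<^sup>2)"
  by (intro continuous_intros continuous_on_gu gu_nz)

lemma integrable_on_ball:
  assumes "continuous_on UNIV (g :: real ^ 'n \<Rightarrow> real)"
  shows "integrable lborel (\<lambda>x. indicator (ball 0 R) x * g x)"
proof -
  have "integrable lborel (\<lambda>x. indicator (cball 0 R) x * g x)"
    by (intro integrable_indicator_compact assms) auto
  then have "integrable lborel (\<lambda>x. indicator (ball 0 R) x *\<^sub>R (indicator (cball 0 R) x * g x))"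
    by (intro integrable_mult_indicator) auto
  also have "(\<lambda>x. indicator (ball 0 R) x *\<^sub>R (indicator (cball 0 R) x * g x)) = (\<lambda>x. indicator (ball 0 R) x * g x)"
    by (auto simp: indicator_def fun_eq_iff)
  finally show ?thesis .
qed

text \<open>By quadratic growth each dyadic term costs at most 128/4^k * C0 * 4^(k+1) = 512 C0; N
  such terms over N^2 give the factor 1/N. The condition on \<open>m\<close> puts every radius in
  the range of the growth hypothesis.\<close>

lemma log_cut_energy:
  assumes E: "\<forall>R\<ge>C0. (\<integral>x. indicator (ball 0 R) x * (rho x * (a (norm (gu x)) * (norm (gu x))\<^sup>2)) \<partial>lborel) \<le> C0 * R\<^sup>2"
    and m: "C0 \<le> 2 ^ m" and N: "0 < N"
  shows "(\<integral>x. rho x * (a (norm (gu x)) * (norm (gu x))\<^sup>2 * (norm (log_cut_grad m N x))\<^sup>2) \<partial>lborel) \<le> 512 * C0 / N"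
proof -
  let ?e = "\<lambda>x. rho x * (a (norm (gu x)) * (norm (gu x))\<^sup>2)"
  have e0: "0 \<le> ?e x" for x using a_pos[of "norm (gu x)"] by simp
  have i: "integrable lborel (\<lambda>x. indicator (ball 0 R) x * ?e x)" for R
    by (intro integrable_on_ball continuous_intros continuous_on_energy)
  have i1: "integrable lborel (\<lambda>x. rho x * (a (norm (gu x)) * (norm (gu x))\<^sup>2 * (norm (log_cut_grad m N x))\<^sup>2))"
    by (rule integrable_continuous_compact_support[where R="2 ^ (m + N)"])
       (auto intro!: continuous_intros continuous_on_gu continuous_on_log_cut_grad
         support_gradient_zero[OF log_cut_deriv log_cut_eq_0])
  have "(\<integral>x. rho x * (a (norm (gu x)) * (norm (gu x))\<^sup>2 * (norm (log_cut_grad m N x))\<^sup>2) \<partial>lborel)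
      \<le> (\<integral>x. 1 / (real N)\<^sup>2 * (\<Sum>k=m..<m+N. 128 / 4 ^ k * (indicator (ball 0 (2 ^ Suc k)) x * ?e x)) \<partial>lborel)"
  proof (rule integral_mono[OF i1])
    fix x
    show "rho x * (a (norm (gu x)) * (norm (gu x))\<^sup>2 * (norm (log_cut_grad m N x))\<^sup>2)
      \<le> 1 / (real N)\<^sup>2 * (\<Sum>k=m..<m+N. 128 / 4 ^ k * (indicator (ball 0 (2 ^ Suc k)) x * ?e x))"
      using mult_left_mono[OF log_cut_grad_bound[of m N x] e0[of x]]
      by (simp add: sum_distrib_left mult_ac)
  qed (intro integrable_mult_right Bochner_Integration.integrable_sum i)
  also have "\<dots> = 1 / (real N)\<^sup>2 * (\<Sum>k=m..<m+N. 128 / 4 ^ k * (\<integral>x. indicator (ball 0 (2 ^ Suc k)) x * ?e x \<partial>lborel))"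
    by (simp only: integral_mult_right_zero Bochner_Integration.integral_sum integrable_mult_right i)
  also have "\<dots> \<le> 1 / (real N)\<^sup>2 * (\<Sum>k=m..<m+N. 512 * C0)"
  proof (intro mult_left_mono sum_mono)
    fix k assume k: "k \<in> {m..<m+N}"
    then have "(2::real) ^ m \<le> 2 ^ Suc k" by (intro power_increasing) auto
    then have "(\<integral>x. indicator (ball 0 (2 ^ Suc k)) x * ?e x \<partial>lborel) \<le> C0 * (2 ^ Suc k)\<^sup>2"
      using m by (intro E[rule_format]) linarith
    then have "128 / 4 ^ k * (\<integral>x. indicator (ball 0 (2 ^ Suc k)) x * ?e x \<partial>lborel) \<le> 128 / 4 ^ k * (C0 * (2 ^ Suc k)\<^sup>2)"
      by (intro mult_left_mono) auto
    also have "\<dots> = 512 * C0" by (simp add: four_power power_mult_distrib)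
    finally show "128 / 4 ^ k * (\<integral>x. indicator (ball 0 (2 ^ Suc k)) x * ?e x \<partial>lborel) \<le> 512 * C0" .
  qed auto
  also have "\<dots> = 512 * C0 / N" using N by (simp add: power2_eq_square)
  finally show ?thesis .
qed

text \<open>The vector is the gradient of the ratio of quotients W/H. The cut-off energy and the
  Picone remainder each take half of \<epsilon>.\<close>

lemma quotient_gradient_vanishes:
  assumes E: "\<forall>R\<ge>C0. (\<integral>x. indicator (ball 0 R) x * (rho x * (a (norm (gu x)) * (norm (gu x))\<^sup>2)) \<partial>lborel) \<le> C0 * R\<^sup>2"
    and v: "norm v \<le> 1" and \<epsilon>: "0 < \<epsilon>"
  shows "\<forall>\<^sub>F t in at_right 0. (\<integral>x. indicator (cball 0 r) x *
      (norm ((1 / D t e x) *\<^sub>R (gD t v x - (D t v x / D t e x) *\<^sub>R gD t e x)))\<^sup>2 \<partial>lborel) \<le> \<epsilon>"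
proof -
  define Y where "Y = (\<lambda>t x. gD t v x - (D t v x / D t e x) *\<^sub>R gD t e x)"
  \<comment> \<open>The cut-off must equal 1 on the given ball, and its radii must lie beyond
    \<open>C0\<close>.\<close>
  obtain m :: nat where m: "max r C0 < 2 ^ m" using real_arch_pow[of 2 "max r C0"] by auto
  \<comment> \<open>Bounds from below the weight, the ellipticity and the square of \<partial>_e u
    together; this converts the weighted energy of \<open>Y\<close> into the unweighted energy of
    Y/H.\<close>
  obtain B where B: "1 \<le> B" "\<And>x. x \<in> cball 0 r \<Longrightarrow> norm (inverse (rho x * (ell (gu x) * (gu x \<bullet> e)\<^sup>2))) \<le> B"
    by (rule bounded_on_cball[of "\<lambda>x. inverse (rho x * (ell (gu x) * (gu x \<bullet> e)\<^sup>2))" r])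
       (use ell_pos[OF gu_nz] monotone in \<open>auto intro!: continuous_intros continuous_on_inverse continuous_on_ell_gu continuous_on_gu
          simp: less_imp_neq[symmetric]\<close>)
  obtain B0 where B0: "1 \<le> B0" "\<And>x. x \<in> cball 0 r \<Longrightarrow> norm (inverse (gu x \<bullet> e)) \<le> B0"
    by (rule bounded_on_cball[of "\<lambda>x. inverse (gu x \<bullet> e)" r])
       (use monotone in \<open>auto intro!: continuous_intros continuous_on_gu simp: less_imp_neq[symmetric]\<close>)
  \<comment> \<open>4 B is the price of that conversion (the 4 comes from H >= h/2), and 4 M * 512
    C0 / N is the Picone bound for this cut-off.\<close>
  obtain N :: nat where N: "4 * B * (4 * M * (512 * C0)) / (\<epsilon> / 2) < real N" "0 < N"
    using reals_Archimedean2[of "max 0 (4 * B * (4 * M * (512 * C0)) / (\<epsilon> / 2))"] by auto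
  have N': "4 * B * (4 * M * (512 * C0 / real N)) \<le> \<epsilon> / 2"
    using N \<epsilon> by (simp add: field_simps)
  have e1: "norm e \<le> 1" using e_unit by simp
  let ?\<eta> = "log_cut m N :: real^'n \<Rightarrow> real"
  have \<delta>: "0 < \<epsilon> / (8 * B)" using \<epsilon> B by simp
  have B02: "0 < 1 / (2 * B0)" using B0(1) by simp
  have picone: "\<forall>\<^sub>F t in at_right 0. (\<integral>x. rho x * ((?\<eta> x)\<^sup>2 * (DF (gu x) (Y t x) \<bullet> Y t x)) \<partial>lborel)
      \<le> 4 * M * (\<integral>x. rho x * (a (norm (gu x)) * (norm (gu x))\<^sup>2 * (norm (log_cut_grad m N x))\<^sup>2) \<partial>lborel) + \<epsilon> / (8 * B)"
    unfolding Y_def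
    by (rule picone_limit[OF v \<delta> log_cut_deriv continuous_on_log_cut_grad log_cut_eq_0 log_cut_bounds[OF N(2)]])
  from eventually_at_right_pos picone D_limit[OF e1 B02, of r]
  show ?thesis
  proof eventually_elim
    case (elim t)
    have t: "t \<noteq> 0" using elim by simp
    have H: "0 < D t e x" for x using D_e_pos elim(1) .
    then have Hn: "D t e x \<noteq> 0" for x by (metis less_irrefl)
    have c\<eta>: "continuous_on A ?\<eta>" for A
      by (rule has_derivative_continuous_on[OF has_derivative_at_withinI[OF log_cut_deriv]])
    have cY: "continuous_on A (Y t)" for A
      unfolding Y_def by (intro continuous_intros t ballI Hn)
    let ?iY = "\<lambda>x. rho x * ((?\<eta> x)\<^sup>2 * (DF (gu x) (Y t x) \<bullet> Y t x))"
    have iY: "integrable lborel ?iY"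
      by (rule integrable_continuous_compact_support[where R="2 ^ (m + N)"])
         (auto intro!: continuous_intros c\<eta> cY continuous_on_gu simp: log_cut_eq_0)
    have iL: "integrable lborel (\<lambda>x. indicator (cball 0 r) x * (norm ((1 / D t e x) *\<^sub>R Y t x))\<^sup>2)"
      by (intro integrable_indicator_compact continuous_intros cY t ballI Hn) auto
    have "(\<integral>x. indicator (cball 0 r) x * (norm ((1 / D t e x) *\<^sub>R Y t x))\<^sup>2 \<partial>lborel) \<le> (\<integral>x. 4 * B * ?iY x \<partial>lborel)"
    proof (intro integral_mono iL integrable_mult_right iY)
      fix x
      show "indicator (cball 0 r) x * (norm ((1 / D t e x) *\<^sub>R Y t x))\<^sup>2 \<le> 4 * B * ?iY x"
      proof (cases "x \<in> cball 0 r")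
        case False
        then show ?thesis using DF_nonneg[OF gu_nz, of x "Y t x"] B(1) by simp
      next
        case x: True
        define h where "h = gu x \<bullet> e"
        have h: "0 < h" using monotone by (simp add: h_def)
        define l where "l = ell (gu x)"
        have l: "0 < l" using ell_pos[OF gu_nz] by (simp add: l_def)
        have "\<bar>D t e x - h\<bar> < 1 / (2 * B0)" using elim(3) x by (simp add: h_def)
        moreover have "1 / B0 = 2 * (1 / (2 * B0))" by simp
        moreover have "1 / B0 \<le> h"
          using B0(2)[OF x] B0(1) h by (simp add: h_def field_simps)
        ultimately have Hh: "h / 2 \<le> D t e x" by linarith
        have "?\<eta> x = 1" using x m N by (intro log_cut_eq_1) auto
        have "1 \<le> B * (rho x * (l * h\<^sup>2))"
          using B(2)[OF x] h l unfolding h_def[symmetric] l_def[symmetric]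
          by (simp add: field_simps abs_mult)
        have "(norm ((1 / D t e x) *\<^sub>R Y t x))\<^sup>2 = (norm (Y t x))\<^sup>2 / (D t e x)\<^sup>2"
          by (simp add: power_divide)
        also have "\<dots> \<le> (norm (Y t x))\<^sup>2 / (h / 2)\<^sup>2"
          using Hh h H[of x] by (intro divide_left_mono power_mono mult_pos_pos) auto
        also have "\<dots> = 4 / h\<^sup>2 * (norm (Y t x))\<^sup>2 * 1" by (simp add: power_divide)
        also have "\<dots> \<le> 4 / h\<^sup>2 * (norm (Y t x))\<^sup>2 * (B * (rho x * (l * h\<^sup>2)))"
          by (intro mult_left_mono \<open>1 \<le> B * _\<close>) auto
        also have "\<dots> = 4 * B * (rho x * (l * (norm (Y t x))\<^sup>2))" using h by (simp add: field_simps)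
        also have "\<dots> \<le> 4 * B * (rho x * (DF (gu x) (Y t x) \<bullet> Y t x))"
          unfolding l_def using B(1) by (intro mult_left_mono DF_lower gu_nz) auto
        finally show ?thesis using x \<open>?\<eta> x = 1\<close> by simp
      qed
    qed
    also have "\<dots> = 4 * B * (\<integral>x. ?iY x \<partial>lborel)" by (rule integral_mult_right_zero)
    also have "\<dots> \<le> 4 * B * (4 * M * (512 * C0 / real N) + \<epsilon> / (8 * B))"
    proof (intro mult_left_mono)
      have "(\<integral>x. rho x * (a (norm (gu x)) * (norm (gu x))\<^sup>2 * (norm (log_cut_grad m N x))\<^sup>2) \<partial>lborel) \<le> 512 * C0 / N"
        using m N by (intro log_cut_energy E) auto
      then have "4 * M * (\<integral>x. rho x * (a (norm (gu x)) * (norm (gu x))\<^sup>2 * (norm (log_cut_grad m N x))\<^sup>2) \<partial>lborel) \<le> 4 * M * (512 * C0 / real N)"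
        using M_ge1 by (intro mult_left_mono) auto
      with elim(2) show "(\<integral>x. ?iY x \<partial>lborel) \<le> 4 * M * (512 * C0 / real N) + \<epsilon> / (8 * B)" by linarith
    qed (use B in auto)
    also have "\<dots> = 4 * B * (4 * M * (512 * C0 / real N)) + \<epsilon> / 2"
      unfolding distrib_left using B(1) by simp
    also have "\<dots> \<le> \<epsilon>" using N' by linarith
    finally show ?case unfolding Y_def .
  qed
qed

text \<open>Apply \<open>limit_constant\<close> to the ratios of quotients. Since x and y are
  arbitrary, the one inequality already means constancy.\<close>

lemma derivative_ratio_constant:
  assumes E: "\<forall>R\<ge>C0. (\<integral>x. indicator (ball 0 R) x * (rho x * (a (norm (gu x)) * (norm (gu x))\<^sup>2)) \<partial>lborel) \<le> C0 * R\<^sup>2"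
    and v: "norm v \<le> 1"
  shows "(gu y \<bullet> v) / (gu y \<bullet> e) \<le> (gu x \<bullet> v) / (gu x \<bullet> e)"
proof (rule limit_constant[where s = "\<lambda>t x. D t v x / D t e x"
      and gs = "\<lambda>t x. (1 / D t e x) *\<^sub>R (gD t v x - (D t v x / D t e x) *\<^sub>R gD t e x)"
      and \<sigma> = "\<lambda>x. (gu x \<bullet> v) / (gu x \<bullet> e)"])
  fix t :: real and x assume t: "0 < t"
  have Hn: "D t e x \<noteq> 0" for x using D_e_pos[OF t, of x] by simp
  show "((\<lambda>x. D t v x / D t e x) has_derivative
      (\<lambda>h. ((1 / D t e x) *\<^sub>R (gD t v x - (D t v x / D t e x) *\<^sub>R gD t e x)) \<bullet> h)) (at x)"
    by (rule has_derivative_eq_rhs, rule has_derivative_divide'[OF D_deriv D_deriv Hn])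
       (use Hn[of x] in \<open>auto simp: fun_eq_iff inner_diff_left field_simps power2_eq_square\<close>)
  show "continuous_on UNIV (\<lambda>x. (1 / D t e x) *\<^sub>R (gD t v x - (D t v x / D t e x) *\<^sub>R gD t e x))"
    using t Hn by (intro continuous_intros) auto
next
  fix r \<epsilon> :: real assume "0 < \<epsilon>"
  then show "\<forall>\<^sub>F t in at_right 0. (\<integral>x. indicator (cball 0 r) x *
      (norm ((1 / D t e x) *\<^sub>R (gD t v x - (D t v x / D t e x) *\<^sub>R gD t e x)))\<^sup>2 \<partial>lborel) \<le> \<epsilon>"
    by (rule quotient_gradient_vanishes[OF E v])
next
  show "continuous_on UNIV (\<lambda>x. (gu x \<bullet> v) / (gu x \<bullet> e))"
    using monotone by (auto intro!: continuous_intros continuous_on_gu simp: less_imp_neq[symmetric])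
next
  fix r \<epsilon> :: real assume \<epsilon>: "0 < \<epsilon>"
  have e1: "norm e \<le> 1" using e_unit by simp
  obtain B0 where B0: "1 \<le> B0" "\<And>x. x \<in> cball 0 r \<Longrightarrow> norm (inverse (gu x \<bullet> e)) \<le> B0"
    by (rule bounded_on_cball[of "\<lambda>x. inverse (gu x \<bullet> e)" r])
       (use monotone in \<open>auto intro!: continuous_intros continuous_on_gu simp: less_imp_neq[symmetric]\<close>)
  obtain B1 where B1: "1 \<le> B1" "\<And>x. x \<in> cball 0 r \<Longrightarrow> norm ((gu x \<bullet> v) / (gu x \<bullet> e)) \<le> B1"
    by (rule bounded_on_cball[of "\<lambda>x. (gu x \<bullet> v) / (gu x \<bullet> e)" r])
       (use monotone in \<open>auto intro!: continuous_intros continuous_on_gu simp: less_imp_neq[symmetric]\<close>)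
  \<comment> \<open>Chosen so that (\<delta> + B1 \<delta>) / H is at most 2 B1 \<delta> * 2 B0 =
    \<epsilon>.\<close>
  define \<delta> where "\<delta> = \<epsilon> / (4 * B0 * B1)"
  have \<delta>: "0 < \<delta>" using \<epsilon> B0 B1 by (simp add: \<delta>_def)
  have B02: "0 < 1 / (2 * B0)" using B0(1) by simp
  show "\<forall>\<^sub>F t in at_right 0. \<forall>x\<in>cball 0 r. \<bar>D t v x / D t e x - (gu x \<bullet> v) / (gu x \<bullet> e)\<bar> < \<epsilon>"
    using eventually_at_right_pos D_limit[OF v \<delta>, of r] D_limit[OF e1 \<delta>, of r] D_limit[OF e1 B02, of r]
  proof eventually_elim
    case (elim t)
    show ?case
    proof
      fix x :: "real^'n" assume x: "x \<in> cball 0 r"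
      define h w H W where "h = gu x \<bullet> e" and "w = gu x \<bullet> v" and "H = D t e x" and "W = D t v x"
      have h: "0 < h" using monotone by (simp add: h_def)
      have H: "0 < H" using D_e_pos[OF elim(1)] by (simp add: H_def)
      have "\<bar>H - h\<bar> < 1 / (2 * B0)" using elim(4) x by (simp add: h_def H_def)
      moreover have "1 / B0 = 2 * (1 / (2 * B0))" by simp
      moreover have "1 / B0 \<le> h"
        using B0(2)[OF x] B0(1) h by (simp add: h_def field_simps)
      ultimately have "1 / (2 * B0) \<le> H" by linarith
      then have Hi: "1 / H \<le> 2 * B0" using H B0(1) by (simp add: field_simps)
      have wh: "\<bar>w / h\<bar> \<le> B1" using B1(2)[OF x] by (simp add: w_def h_def)
      have a: "\<bar>W - w\<bar> < \<delta>" "\<bar>H - h\<bar> < \<delta>"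
        using elim(2,3) x by (auto simp: W_def w_def H_def h_def)
      have "W / H - w / h = ((W - w) - w / h * (H - h)) * (1 / H)"
        using h H by (simp add: field_simps)
      also have "\<bar>\<dots>\<bar> = \<bar>(W - w) - w / h * (H - h)\<bar> * (1 / H)" using H by (simp add: abs_mult)
      also have "\<dots> < (\<delta> + B1 * \<delta>) * (1 / H)"
      proof (rule mult_strict_right_mono)
        have "\<bar>w / h * (H - h)\<bar> \<le> B1 * \<delta>"
          unfolding abs_mult using wh a \<delta> B1 by (intro mult_mono) auto
        then show "\<bar>(W - w) - w / h * (H - h)\<bar> < \<delta> + B1 * \<delta>" using a by linarith
      qed (use H in auto)
      also have "\<dots> \<le> (2 * B1 * \<delta>) * (2 * B0)"
        using Hi H \<delta> B1(1) by (intro mult_mono) auto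
      also have "\<dots> = \<epsilon>" using B0(1) B1(1) by (simp add: \<delta>_def)
      finally show "\<bar>D t v x / D t e x - (gu x \<bullet> v) / (gu x \<bullet> e)\<bar> < \<epsilon>"
        by (simp add: W_def w_def H_def h_def)
    qed
  qed
qed

text \<open>Constant ratios make every gradient a multiple of one vector \<open>c\<close>,
  normalised by c . e = 1. Hence u does not change along directions orthogonal to
  \<open>c\<close>.\<close>

lemma one_dimensional_if_energy_quadratic:
  assumes E: "\<forall>R\<ge>C0. (\<integral>x. indicator (ball 0 R) x * (rho x * (a (norm (gu x)) * (norm (gu x))\<^sup>2)) \<partial>lborel) \<le> C0 * R\<^sup>2"
  shows "one_dimensional u"
proof -
  define c where "c = (1 / (gu 0 \<bullet> e)) *\<^sub>R gu 0"
  have gu: "gu x = (gu x \<bullet> e) *\<^sub>R c" for x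
  proof (rule euclidean_eqI)
    fix b :: "real^'n" assume "b \<in> Basis"
    then have "norm b \<le> 1" by simp
    from derivative_ratio_constant[OF E this, of x 0] derivative_ratio_constant[OF E this, of 0 x]
    have "(gu x \<bullet> b) / (gu x \<bullet> e) = (gu 0 \<bullet> b) / (gu 0 \<bullet> e)" by simp
    then show "gu x \<bullet> b = (gu x \<bullet> e) *\<^sub>R c \<bullet> b"
      using monotone[of x] by (simp add: c_def field_simps)
  qed
  have c: "c \<noteq> 0" using monotone[of 0] by (auto simp: c_def)
  define \<omega> where "\<omega> = (1 / norm c) *\<^sub>R c"
  have \<omega>: "norm \<omega> = 1" using c by (simp add: \<omega>_def)
  have "u x = u ((\<omega> \<bullet> x) *\<^sub>R \<omega>)" for x
  proof -
    \<comment> \<open>Displacement from \<open>x\<close> to its projection on the \<omega> axis; it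
      is orthogonal to every gradient.\<close>
    define z where "z = (\<omega> \<bullet> x) *\<^sub>R \<omega> - x"
    have "\<omega> \<bullet> z = 0" using \<omega> by (simp add: z_def inner_diff_right norm_eq_1)
    then have cz: "c \<bullet> z = 0" using c by (simp add: \<omega>_def)
    obtain s where "u (x + 1 *\<^sub>R z) - u x = 1 * (gu (x + s *\<^sub>R z) \<bullet> z)"
      using directional_MVT[OF u_deriv, of 1 x z] by auto
    moreover have "gu (x + s *\<^sub>R z) \<bullet> z = 0" by (subst gu) (simp add: cz)
    ultimately show ?thesis by (simp add: z_def)
  qed
  then show ?thesis
    unfolding one_dimensional_def using \<omega>
    by (intro bexI[of _ \<omega>] exI[of _ "\<lambda>s. u (s *\<^sub>R \<omega>)"]) auto
qed

text \<open>The bound is uniform in R because the cut-off gradients obey one bound at every scale.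
  The condition a <= 1 controls the cut-off term left by Young's inequality without any bound on
  \<nabla>u.\<close>

lemma energy_bounded:
  assumes a1: "\<And>t. 0 < t \<Longrightarrow> a t \<le> 1" and B: "\<And>x. \<bar>u x\<bar> \<le> B"
  shows "\<exists>C\<ge>0. \<forall>R. (\<integral>x. indicator (ball 0 R) x * (rho x * (a (norm (gu x)) * (norm (gu x))\<^sup>2)) \<partial>lborel) \<le> C"
proof -
  let ?e = "\<lambda>x. a (norm (gu x)) * (norm (gu x))\<^sup>2"
  have e0: "0 \<le> ?e x" for x using a_pos[of "norm (gu x)"] by simp
  have "bounded (f ` {-B..B})"
    by (intro compact_imp_bounded compact_continuous_image continuous_on_f) auto
  then obtain Bf where "\<forall>y\<in>f ` {-B..B}. norm y \<le> Bf" unfolding bounded_iff by blast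
  then have Bf: "\<And>x. x \<in> {-B..B} \<Longrightarrow> \<bar>f x\<bar> \<le> Bf" by simp
  have fB: "\<bar>f (u x)\<bar> \<le> Bf" for x using B[of x] by (intro Bf) (auto simp: abs_le_iff)
  have B0: "0 \<le> B" "0 \<le> Bf" using B[of 0] fB[of 0] by linarith+
  \<comment> \<open>256 B^2 is 2 B^2 from Young's inequality times the bound 128 for the squared
    cut-off gradient.\<close>
  define C where "C = 256 * B\<^sup>2 + Bf * B"
  have C: "0 \<le> C" using B0 by (simp add: C_def)
  define K where "K = (\<integral>x. rho x \<partial>(lborel :: (real^'n) measure))"
  have K: "0 \<le> K" by (simp add: K_def integral_nonneg_AE)
  have "(\<integral>x. indicator (ball 0 R) x * (rho x * ?e x) \<partial>lborel) \<le> 2 * (C * K)" for R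
  proof -
    obtain k :: nat where k: "R < 2 ^ k" using real_arch_pow[of 2 R] by auto
    let ?\<eta> = "bump k :: real^'n \<Rightarrow> real" and ?g = "bump_grad k :: real^'n \<Rightarrow> real^'n"
    let ?\<phi> = "\<lambda>x. (?\<eta> x)\<^sup>2 * u x"
    let ?d = "\<lambda>x. (?\<eta> x)\<^sup>2 *\<^sub>R gu x + (2 * ?\<eta> x * u x) *\<^sub>R ?g x"
    have z\<eta>: "?\<eta> x = 0" if "norm x > 2 ^ Suc k" for x using that by (intro bump_eq_0) simp
    have c\<eta>: "continuous_on A ?\<eta>" for A
      by (rule has_derivative_continuous_on[OF has_derivative_at_withinI[OF bump_deriv]])
    have zg: "?g x = 0" if "norm x > 2 ^ Suc k" for x
      by (rule support_gradient_zero[OF bump_deriv z\<eta> that])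
    have d: "(?\<phi> has_derivative (\<lambda>h. ?d x \<bullet> h)) (at x)" for x
      by (rule has_derivative_eq_rhs, rule has_derivative_mult[OF has_derivative_power[OF bump_deriv] u_deriv])
         (auto simp: inner_add_left algebra_simps)
    have c: "continuous_on UNIV ?d"
      by (intro continuous_intros c\<eta> continuous_on_u continuous_on_gu)
    have z: "?\<phi> x = 0" if "norm x > 2 ^ Suc k" for x using z\<eta>[OF that] by simp
    have q: "(\<integral>x. rho x * (F (gu x) \<bullet> ?d x - f (u x) * ?\<phi> x) \<partial>lborel) = 0"
      by (rule weak_lborel[OF d c z])
    have iq: "integrable lborel (\<lambda>x. rho x * (F (gu x) \<bullet> ?d x - f (u x) * ?\<phi> x))"
      by (rule integrable_continuous_compact_support[where R="2 ^ Suc k"])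
         (auto intro!: continuous_intros c\<eta> continuous_on_u continuous_on_gu simp del: power_Suc simp: z\<eta> zg)
    have ie: "integrable lborel (\<lambda>x. rho x * ((?\<eta> x)\<^sup>2 * ?e x))"
      by (rule integrable_continuous_compact_support[where R="2 ^ Suc k"])
         (auto intro!: continuous_intros c\<eta> continuous_on_gu simp del: power_Suc simp: z\<eta>)
    have "(\<integral>x. 1 / 2 * (rho x * ((?\<eta> x)\<^sup>2 * ?e x)) - C * rho x \<partial>lborel) \<le> (\<integral>x. rho x * (F (gu x) \<bullet> ?d x - f (u x) * ?\<phi> x) \<partial>lborel)"
    proof (intro integral_mono iq Bochner_Integration.integrable_diff integrable_mult_right ie gaussian_finite)
      fix x :: "real^'n"
      define n A where "n = norm (gu x)" and "A = a n"
      have A: "0 < A" "A \<le> 1" "0 < n" using a_pos[of "norm (gu x)"] a1[of "norm (gu x)"] by (auto simp: A_def n_def)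
      have g2: "(norm (?g x))\<^sup>2 \<le> 128"
      proof -
        have "128 / 4 ^ k * indicator (ball 0 (2 ^ Suc k)) x \<le> (128::real)"
          by (auto simp: indicator_def divide_le_eq)
        then show ?thesis using bump_grad_bound[of k x] by linarith
      qed
      have \<eta>2: "(?\<eta> x)\<^sup>2 \<le> 1" using bump_bounds[of k x] by (simp add: power_le_one)
      have e: "F (gu x) \<bullet> ?d x = (?\<eta> x)\<^sup>2 * (A * n\<^sup>2) + 2 * ?\<eta> x * u x * (A * (gu x \<bullet> ?g x))"
        by (simp add: F_def A_def n_def inner_add_right power2_norm_eq_inner algebra_simps)
      have "\<bar>2 * ?\<eta> x * u x * (A * (gu x \<bullet> ?g x))\<bar> = A * (2 * (?\<eta> x * (\<bar>u x\<bar> * \<bar>gu x \<bullet> ?g x\<bar>)))"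
        using A bump_bounds[of k x] by (simp add: abs_mult)
      also have "\<dots> \<le> A * (2 * (?\<eta> x * (B * (n * norm (?g x)))))"
        unfolding n_def using A B B0 bump_bounds[of k x]
        by (intro mult_left_mono mult_mono Cauchy_Schwarz_ineq2) auto
      also have "\<dots> = A * (2 * (?\<eta> x * n) * (B * norm (?g x)))" by simp
      also have "\<dots> \<le> A * ((?\<eta> x * n)\<^sup>2 / 2 + 2 * (B * norm (?g x))\<^sup>2)"
      proof (intro mult_left_mono)
        have "0 \<le> (?\<eta> x * n - 2 * (B * norm (?g x)))\<^sup>2" by simp
        then show "2 * (?\<eta> x * n) * (B * norm (?g x)) \<le> (?\<eta> x * n)\<^sup>2 / 2 + 2 * (B * norm (?g x))\<^sup>2"
          unfolding power2_diff by (simp add: power_mult_distrib)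
      qed (use A in auto)
      also have "\<dots> = 1 / 2 * ((?\<eta> x)\<^sup>2 * (A * n\<^sup>2)) + A * (2 * (B\<^sup>2 * (norm (?g x))\<^sup>2))"
        by (simp add: power_mult_distrib algebra_simps)
      also have "A * (2 * (B\<^sup>2 * (norm (?g x))\<^sup>2)) \<le> 1 * (2 * (B\<^sup>2 * 128))"
        using A g2 by (intro mult_mono) auto
      finally have 1: "\<bar>2 * ?\<eta> x * u x * (A * (gu x \<bullet> ?g x))\<bar> \<le> 1 / 2 * ((?\<eta> x)\<^sup>2 * (A * n\<^sup>2)) + 256 * B\<^sup>2" by simp
      have "\<bar>f (u x) * ?\<phi> x\<bar> \<le> Bf * (1 * B)"
        unfolding abs_mult using fB B B0 \<eta>2 by (intro mult_mono) auto
      then have "1 / 2 * ((?\<eta> x)\<^sup>2 * ?e x) - C \<le> F (gu x) \<bullet> ?d x - f (u x) * ?\<phi> x"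
        using 1 unfolding e C_def n_def[symmetric] A_def[symmetric] by linarith
      from mult_left_mono[OF this rho_nonneg[of x]]
      show "1 / 2 * (rho x * ((?\<eta> x)\<^sup>2 * ?e x)) - C * rho x \<le> rho x * (F (gu x) \<bullet> ?d x - f (u x) * ?\<phi> x)"
        by (simp only: right_diff_distrib) (simp add: mult_ac)
    qed
    also have "\<dots> = 0" by (rule q)
    also have "(\<integral>x. 1 / 2 * (rho x * ((?\<eta> x)\<^sup>2 * ?e x)) - C * rho x \<partial>lborel) = 1 / 2 * (\<integral>x. rho x * ((?\<eta> x)\<^sup>2 * ?e x) \<partial>lborel) - C * K"
      unfolding K_def
      by (simp only: Bochner_Integration.integral_diff integral_mult_right_zero integrable_mult_right ie gaussian_finite)
    finally have "(\<integral>x. rho x * ((?\<eta> x)\<^sup>2 * ?e x) \<partial>lborel) \<le> 2 * (C * K)" by linarith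
    moreover have "(\<integral>x. indicator (ball 0 R) x * (rho x * ?e x) \<partial>lborel) \<le> (\<integral>x. rho x * ((?\<eta> x)\<^sup>2 * ?e x) \<partial>lborel)"
    proof (intro integral_mono ie integrable_on_ball continuous_intros continuous_on_energy)
      fix x :: "real^'n"
      show "indicator (ball 0 R) x * (rho x * ?e x) \<le> rho x * ((?\<eta> x)\<^sup>2 * ?e x)"
        using k e0[of x] bump_eq_1[of x k] by (auto simp: indicator_def)
    qed auto
    ultimately show ?thesis by linarith
  qed
  then show ?thesis using C K by (intro exI[of _ "2 * (C * K)"]) auto
qed

end

section \<open>The model coefficients\<close>

text \<open>The set where the bound fails is open, and a nonempty open set is not negligible. This
  turns essential bounds into pointwise ones.\<close>

lemma AE_bound_continuous:
  fixes g :: "'a::euclidean_space \<Rightarrow> real"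
  assumes "continuous_on UNIV g" "AE x in lebesgue. \<bar>g x\<bar> \<le> C"
  shows "\<bar>g x\<bar> \<le> C"
proof (rule ccontr)
  assume "\<not> ?thesis"
  define U where "U = {x. C < \<bar>g x\<bar>}"
  have U: "open U" "x \<in> U"
    using assms(1) \<open>\<not> _\<close> by (auto simp: U_def intro!: open_Collect_less continuous_intros)
  then have "U \<in> sets lebesgue" by (simp add: borel_open)
  moreover have "{x \<in> space lebesgue. \<not> \<bar>g x\<bar> \<le> C} = U" by (auto simp: U_def)
  ultimately have "U \<in> null_sets lebesgue"
    using AE_iff_null[of lebesgue "\<lambda>x. \<bar>g x\<bar> \<le> C"] assms(2) by simp
  then show False using open_not_negligible[OF U(1)] U(2) by (auto simp: negligible_iff_null_sets)
qed

text \<open>The radial eigenvalue is (p - 1) t^(p-2): positive because p > 1, and p - 1 times the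
  tangential one, whence the choice of \<open>M\<close>.\<close>

lemma elliptic_power:
  assumes "1 < p"
  shows "elliptic (\<lambda>t. t powr (p - 2)) (\<lambda>t. (p - 2) * t powr (p - 3)) (max 1 (p - 1))"
proof
  fix t :: real assume t: "0 < t"
  show "((\<lambda>t. t powr (p - 2)) has_real_derivative (p - 2) * t powr (p - 3)) (at t)"
    using t by (auto intro!: derivative_eq_intros simp: powr_diff field_simps eval_nat_numeral)
  have "t * t powr (p - 3) = t powr (p - 2)"
    using t powr_add[of t 1 "p - 3"] by simp
  then have e: "t powr (p - 2) + t * ((p - 2) * t powr (p - 3)) = (p - 1) * t powr (p - 2)"
    by (simp add: algebra_simps)
  show "0 < t powr (p - 2)" using t by simp
  show "0 < t powr (p - 2) + t * ((p - 2) * t powr (p - 3))"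
    unfolding e using t assms by simp
  show "t powr (p - 2) + t * ((p - 2) * t powr (p - 3)) \<le> max 1 (p - 1) * t powr (p - 2)"
    unfolding e by (intro mult_right_mono) auto
qed (auto intro!: continuous_intros)

lemma elliptic_one: "elliptic (\<lambda>t. 1) (\<lambda>t. 0) 1"
  by unfold_locales auto

text \<open>The radial eigenvalue collapses to (1 + t^q)^(-1/q - 1). Since a is decreasing, it lies
  below the tangential one and M = 1 suffices.\<close>

lemma elliptic_mean_curvature:
  assumes q: "1 < q"
  shows "elliptic (\<lambda>t. (1 + t powr q) powr (- 1 / q)) (\<lambda>t. - (t powr (q - 1) * (1 + t powr q) powr (- 1 / q - 1))) 1"
proof
  fix t :: real assume t: "0 < t"
  have pos: "0 < 1 + t powr q" using t by (simp add: add_pos_pos)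
  have "((\<lambda>t. (1 + t powr q) powr (- 1 / q)) has_real_derivative
      (- 1 / q) * (1 + t powr q) powr (- 1 / q - 1) * (q * t powr (q - 1))) (at t)"
    using t pos q by (auto intro!: derivative_eq_intros)
  then show "((\<lambda>t. (1 + t powr q) powr (- 1 / q)) has_real_derivative
      - (t powr (q - 1) * (1 + t powr q) powr (- 1 / q - 1))) (at t)"
    by (rule DERIV_cong) (use q in simp)
  have "t * t powr (q - 1) = t powr q" using t powr_add[of t 1 "q - 1"] by simp
  moreover have "(1 + t powr q) * (1 + t powr q) powr (- 1 / q - 1) = (1 + t powr q) powr (- 1 / q)"
    using pos powr_add[of "1 + t powr q" 1 "- 1 / q - 1"] by simp
  ultimately have e: "(1 + t powr q) powr (- 1 / q) + t * - (t powr (q - 1) * (1 + t powr q) powr (- 1 / q - 1))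
      = (1 + t powr q) powr (- 1 / q - 1)"
    by (simp add: algebra_simps) (metis mult.assoc)
  show "0 < (1 + t powr q) powr (- 1 / q)" using pos by simp
  show "0 < (1 + t powr q) powr (- 1 / q) + t * - (t powr (q - 1) * (1 + t powr q) powr (- 1 / q - 1))"
    unfolding e using pos by simp
  show "(1 + t powr q) powr (- 1 / q) + t * - (t powr (q - 1) * (1 + t powr q) powr (- 1 / q - 1))
      \<le> 1 * (1 + t powr q) powr (- 1 / q)"
    using t by simp
qed (auto intro!: continuous_intros simp: add_pos_pos less_imp_neq[symmetric])

lemma mean_curvature_le_one:
  fixes q t :: real
  assumes "1 < q" shows "(1 + t powr q) powr (- 1 / q) \<le> 1"
proof -
  have "(1 + t powr q) powr (- 1 / q) \<le> (1 + t powr q) powr 0"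
    using assms by (intro powr_mono) auto
  moreover have "1 + t powr q \<noteq> 0" using powr_ge_zero[of t q] by linarith
  ultimately show ?thesis by simp
qed

section \<open>Reduction of the hypotheses to quadratic energy growth\<close>

lemma monotone_solutionI:
  fixes u :: "real ^ 'n \<Rightarrow> real"
  assumes "elliptic a a' M" "f C1_differentiable_on UNIV" "monotone_weak_solution a f u"
  shows "\<exists>f' e. monotone_solution a a' M u f f' e"
proof -
  interpret elliptic a a' M by fact
  obtain f' where f': "\<And>s. (f has_vector_derivative f' s) (at s)" "continuous_on UNIV f'"
    using assms(2) unfolding C1_differentiable_on_def by auto
  have w: "weak_solution a f u" using assms(3) by (simp add: monotone_weak_solution_def)
  obtain i where i: "\<And>x. gradient u x $ i > 0"
    using assms(3) unfolding monotone_weak_solution_def by auto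
  have "monotone_solution a a' M u f f' (axis i 1)"
  proof
    show "C1 u" using w by (simp add: weak_solution_def)
    show "(f has_real_derivative f' s) (at s)" for s
      using f'(1) by (simp add: has_real_derivative_iff_has_vector_derivative)
    show "continuous_on UNIV f'" by fact
    show "0 < gradient u x \<bullet> axis i 1" for x using i by (simp add: inner_axis)
    show "(\<integral>x. (a (norm (gradient u x)) *\<^sub>R gradient u x) \<bullet> gradient \<phi> x - f (u x) * \<phi> x \<partial>\<mu>) = 0"
      if "C1_compact_support \<phi>" for \<phi>
      using w that by (simp add: weak_solution_def)
  qed simp
  then show ?thesis by blast
qed

context monotone_solution
begin

lemma energy_density_mu:
  "(LINT x:ball 0 R|\<mu>. energy_density a u x)
    = (\<integral>x. indicator (ball 0 R) x * (rho x * (a (norm (gu x)) * (norm (gu x))\<^sup>2)) \<partial>lborel)"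
proof -
  have "(\<lambda>x. a (norm (gu x)) * (norm (gu x))\<^sup>2) \<in> borel_measurable borel"
    by (intro borel_measurable_continuous_onI continuous_on_energy)
  then have "(\<lambda>x. indicator (ball 0 R) x *\<^sub>R energy_density a u x) \<in> borel_measurable borel"
    unfolding energy_density_def by (intro borel_measurable_scaleR borel_measurable_indicator) auto
  then show ?thesis
    unfolding set_lebesgue_integral_def by (simp add: integral_mu energy_density_def mult_ac)
qed

lemma one_dimensional_quadratic_energy:
  assumes "\<exists>C\<^sub>0\<ge>1. \<forall>R\<ge>C\<^sub>0. (LINT x:ball 0 R|\<mu>. energy_density a u x) \<le> C\<^sub>0 * R\<^sup>2"
  shows "one_dimensional u"
  using assms unfolding energy_density_mu
  by (blast intro: one_dimensional_if_energy_quadratic)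

text \<open>A disc of radius R has area pi R^2, so a pointwise bound on the weighted energy density
  already gives quadratic growth.\<close>

lemma one_dimensional_planar:
  assumes "CARD('n) = 2" "L_infinity (\<lambda>x. energy_density a u x * exp (G x))"
  shows "one_dimensional u"
proof -
  let ?e = "\<lambda>x. rho x * (a (norm (gu x)) * (norm (gu x))\<^sup>2)"
  have ce: "continuous_on UNIV ?e" by (intro continuous_intros continuous_on_energy)
  have e: "(\<lambda>x. energy_density a u x * exp (G x)) = ?e"
    by (auto simp: energy_density_def rho_def mult.commute)
  have "L_infinity ?e" using assms(2) unfolding e .
  then obtain C where C: "AE x in lebesgue. \<bar>?e x\<bar> \<le> C"
    unfolding L_infinity_def by auto
  have le: "?e x \<le> C" for x using AE_bound_continuous[OF ce C, of x] by linarith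
  define C0 where "C0 = max 1 (C * pi)"
  have "(\<integral>x. indicator (ball 0 R) x * ?e x \<partial>lborel) \<le> C0 * R\<^sup>2" if "C0 \<le> R" for R
  proof -
    have R: "0 \<le> R" using that by (simp add: C0_def)
    have "(\<integral>x. indicator (ball 0 R) x * ?e x \<partial>lborel) \<le> (\<integral>x. indicator (ball 0 R) x * C \<partial>(lborel :: (real^'n) measure))"
      using le by (intro integral_mono integrable_on_ball ce) (auto intro!: mult_left_mono)
    also have "\<dots> = C * measure lborel (ball (0 :: real^'n) R)" by simp
    also have "\<dots> = C * (pi * R\<^sup>2)"
      using content_ball[OF R, of "0 :: real^'n"] assms(1) by (simp add: unit_ball_vol_2)
    also have "\<dots> = (C * pi) * R\<^sup>2" by simp
    also have "\<dots> \<le> C0 * R\<^sup>2" unfolding C0_def by (intro mult_right_mono) auto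
    finally show ?thesis .
  qed
  then show ?thesis using one_dimensional_if_energy_quadratic by blast
qed

lemma one_dimensional_bounded:
  assumes "\<And>t. 0 < t \<Longrightarrow> a t \<le> 1" "L_infinity u"
  shows "one_dimensional u"
proof -
  obtain B where "AE x in lebesgue. \<bar>u x\<bar> \<le> B"
    using assms(2) unfolding L_infinity_def by auto
  then have B: "\<bar>u x\<bar> \<le> B" for x by (rule AE_bound_continuous[OF continuous_on_u])
  obtain C where C: "0 \<le> C" "\<And>R. (\<integral>x. indicator (ball 0 R) x * (rho x * (a (norm (gu x)) * (norm (gu x))\<^sup>2)) \<partial>lborel) \<le> C"
    using energy_bounded[OF assms(1) B] by blast
  \<comment> \<open>The maximum with 1 forces R >= 1, where a constant is dominated by a multiple of
    R^2.\<close>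
  define C0 where "C0 = max 1 C"
  have "C \<le> C0 * R\<^sup>2" if "C0 \<le> R" for R
  proof -
    have "1 \<le> R" using that by (simp add: C0_def)
    then have "1 \<le> R\<^sup>2" by simp
    then have "C0 * 1 \<le> C0 * R\<^sup>2" by (intro mult_left_mono) (auto simp: C0_def)
    then show ?thesis by (simp add: C0_def)
  qed
  then have "\<forall>R\<ge>C0. (\<integral>x. indicator (ball 0 R) x * (rho x * (a (norm (gu x)) * (norm (gu x))\<^sup>2)) \<partial>lborel) \<le> C0 * R\<^sup>2"
    using C(2) order_trans by blast
  then show ?thesis by (rule one_dimensional_if_energy_quadratic)
qed

end

theorem theorem2:
  fixes f :: "real \<Rightarrow> real"
  assumes "f C1_differentiable_on UNIV"
  shows
    "(\<forall>(p::real) (a::real \<Rightarrow> real) (u :: real ^ 'n \<Rightarrow> real).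
        p > 1 \<longrightarrow> a = (\<lambda>t. t powr (p - 2)) \<longrightarrow>
        C1 u \<longrightarrow> W_1_infinity u \<longrightarrow> monotone_weak_solution a f u \<longrightarrow>
        (\<exists>C\<^sub>0\<ge>1. \<forall>R\<ge>C\<^sub>0. (LINT x:ball 0 R|\<mu>. energy_density a u x) \<le> C\<^sub>0 * R\<^sup>2) \<or>
        (CARD('n) = 2 \<and> L_infinity (\<lambda>x. energy_density a u x * exp (G x))) \<longrightarrow>
        one_dimensional u) \<and>
     (\<forall>(a::real \<Rightarrow> real) (u :: real ^ 'n \<Rightarrow> real).
        a = (\<lambda>t. 1) \<or> (\<exists>q>1. a = (\<lambda>t. (1 + t powr q) powr (- 1 / q))) \<longrightarrow>
        C1 u \<longrightarrow> L_infinity u \<longrightarrow> monotone_weak_solution a f u \<longrightarrow>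
        one_dimensional u)"
proof (intro conjI allI impI)
  fix p :: real and a :: "real \<Rightarrow> real" and u :: "real ^ 'n \<Rightarrow> real"
  assume p: "1 < p" and a: "a = (\<lambda>t. t powr (p - 2))" and m: "monotone_weak_solution a f u"
    and E: "(\<exists>C\<^sub>0\<ge>1. \<forall>R\<ge>C\<^sub>0. (LINT x:ball 0 R|\<mu>. energy_density a u x) \<le> C\<^sub>0 * R\<^sup>2) \<or>
        (CARD('n) = 2 \<and> L_infinity (\<lambda>x. energy_density a u x * exp (G x)))"
  obtain f' e where "monotone_solution a (\<lambda>t. (p - 2) * t powr (p - 3)) (max 1 (p - 1)) u f f' e"
    using monotone_solutionI[OF elliptic_power[OF p] assms m[unfolded a]] a by blast
  then interpret monotone_solution a "\<lambda>t. (p - 2) * t powr (p - 3)" "max 1 (p - 1)" u f f' e .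
  show "one_dimensional u"
    using E one_dimensional_quadratic_energy one_dimensional_planar by blast
next
  fix a :: "real \<Rightarrow> real" and u :: "real ^ 'n \<Rightarrow> real"
  assume a: "a = (\<lambda>t. 1) \<or> (\<exists>q>1. a = (\<lambda>t. (1 + t powr q) powr (- 1 / q)))"
    and L: "L_infinity u" and m: "monotone_weak_solution a f u"
  have "(\<exists>a'. elliptic a a' 1) \<and> (\<forall>t>0. a t \<le> 1)"
    using a
  proof
    assume "\<exists>q>1. a = (\<lambda>t. (1 + t powr q) powr (- 1 / q))"
    then show ?thesis using elliptic_mean_curvature mean_curvature_le_one by blast
  qed (use elliptic_one in auto)
  then obtain a' where a': "elliptic a a' 1" and a1: "\<And>t. 0 < t \<Longrightarrow> a t \<le> 1" by blast
  obtain f' e where "monotone_solution a a' 1 u f f' e"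
    using monotone_solutionI[OF a' assms m] by blast
  then interpret monotone_solution a a' 1 u f f' e .
  show "one_dimensional u" using a1 L by (rule one_dimensional_bounded)
qed

end
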